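(* Let $\mathbb{K}$ be an algebraically closed field and let $q\in\mathbb{K}^*$ be a primitive $m$-th root of unity. Then each simple right $u_{22}$-torsionfree $A_q(M_2)$-module is isomorphic to one of the simple $A_q(M_2)$-modules of type $N_1$, $N_2$ or $N_3$.
   Context: All modules are right modules. $A_q(M_2)$ (the reflection equation algebra of rank $2$) is the associative unital $\mathbb{K}$-algebra generated by $u_{11},u_{12},u_{21},u_{22}$ with relations $u_{11}u_{22}=u_{22}u_{11}$, $u_{22}u_{12}=q^2u_{12}u_{22}$, $u_{21}u_{22}=q^2u_{22}u_{21}$, $u_{11}u_{12}=u_{12}(u_{11}+(q^{-2}-1)u_{22})$, $u_{21}u_{11}=(u_{11}+(q^{-2}-1)u_{22})u_{21}$, $u_{21}u_{12}-u_{12}u_{21}=(q^{-2}-1)u_{22}(u_{22}-u_{11})$. The element $u_{22}$ is normal; a module $M$ is $u_{22}$-torsionfree if $xu_{22}^i=0$ with $x\in M$, $i\ge0$ implies $x=0$. Put $n:=m$ if $m$ is odd and $n:=m/2$ if $m$ is even. The elements $u_{12}^n,u_{21}^n,u_{22}^n$ are central. Type $N_1$: a simple module with a nonzero vector $v$ satisfying $vu_{12}^n=\alpha v$, $vu_{21}^n=\beta v$, $vu_{11}=\lambda_1v$, $vu_{22}=\lambda_2v$, $vu_{12}u_{21}=\lambda_3v$, where $\alpha,\lambda_1,\lambda_3\in\mathbb{K}$ and $\beta,\lambda_2\in\mathbb{K}^*$, with $\mathbb{K}$-basis $vu_{21}^r$, $0\le r\le n-1$ (so dimension $n$), and action $(vu_{21}^r)u_{11}=(\lambda_1+q^{-2}(1-q^{2r})\lambda_2)vu_{21}^r$;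 $(vu_{21}^r)u_{12}=c_r\,vu_{21}^{r-1}$ for $1\le r\le n-1$, and $vu_{12}=\beta^{-1}\lambda_3vu_{21}^{n-1}$; $(vu_{21}^r)u_{21}=vu_{21}^{r+1}$ for $r\le n-2$, and $=\beta v$ for $r=n-1$; $(vu_{21}^r)u_{22}=q^{2r}\lambda_2vu_{21}^r$; where $c_r=\lambda_3+q^{-2}(q^{2r}-1)\lambda_1\lambda_2+(q^{2r}-q^{4r})q^{-4}\lambda_2^2$. Type $N_2$: a simple module with a nonzero vector $v$ satisfying $vu_{12}^n=\alpha v$, $vu_{21}^n=0$, $vu_{11}=\lambda_1v$, $vu_{22}=\lambda_2v$, $vu_{12}u_{21}=\lambda_3v$, where $\alpha,\lambda_2\in\mathbb{K}^*$, $\lambda_1,\lambda_3\in\mathbb{K}$, with $\mathbb{K}$-basis $vu_{12}^r$, $0\le r\le n-1$ (so dimension $n$). Type $N_3$: a simple module on which $u_{12}^n$ and $u_{21}^n$ act as zero, with a nonzero vector $w$ satisfying $wu_{12}=0$, $wu_{11}=\lambda_1'w$, $wu_{22}=\lambda_2'w$, where $\lambda_1'\in\mathbb{K}$, $\lambda_2'\in\mathbb{K}^*$, with $\mathbb{K}$-basis $wu_{21}^r$, $0\le r\le s-1$, where $s$ is the smallest integer with $1\le s\le n$ and $wu_{21}^s=0$; here $s$ is the integer in $\{1,\dots,n-1\}$ with $\lambda_1'=q^{2s-2}\lambda_2'$ if one exists, and $s=n$ otherwise. The action is $(wu_{21}^r)u_{11}=(\lambda_1'+q^{-2}(1-q^{2r})\lambda_2')wu_{21}^r$;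 $(wu_{21}^r)u_{12}=c_r'\,wu_{21}^{r-1}$ for $1\le r\le s-1$, and $wu_{12}=0$; $(wu_{21}^r)u_{21}=wu_{21}^{r+1}$ for $r\le s-2$, and $=0$ for $r=s-1$; $(wu_{21}^r)u_{22}=q^{2r}\lambda_2'wu_{21}^r$; where $c_r'=q^{-2}(q^{2r}-1)\lambda_1'\lambda_2'+(q^{2r}-q^{4r})q^{-4}(\lambda_2')^2$. *)

theory Defs
  imports
    "HOL-Algebra.QuotRing"
    "HOL-Library.Poly_Mapping"
    "HOL-Computational_Algebra.Polynomial"
begin

section \<open>Free associative algebras\<close>

text \<open>
  The free monoid, written additively so that the convolution product of \<^typ>\<open>'a \<Rightarrow>\<^sub>0 'b\<close>
  makes the finitely supported functions on it into the free associative unital algebra.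
\<close>

datatype 'a free_mon = Word (letters: "'a list")

instantiation free_mon :: (type) monoid_add
begin

definition zero_free_mon :: "'a free_mon" where "0 = Word []"

definition plus_free_mon :: "'a free_mon \<Rightarrow> 'a free_mon \<Rightarrow> 'a free_mon"
  where "x + y = Word (letters x @ letters y)"

instance by standard (simp_all add: zero_free_mon_def plus_free_mon_def)

end

type_synonym ('a, 'k) free_alg = "'a free_mon \<Rightarrow>\<^sub>0 'k"

definition fvar :: "'a \<Rightarrow> ('a, 'k::comm_ring_1) free_alg"
  where "fvar a = Poly_Mapping.single (Word [a]) 1"

definition fconst :: "'k \<Rightarrow> ('a, 'k::comm_ring_1) free_alg"
  where "fconst c = Poly_Mapping.single 0 c"

definition free_alg_ring :: "('a, 'k::comm_ring_1) free_alg ring"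
  where "free_alg_ring = \<lparr>carrier = UNIV, monoid.mult = (*), one = 1, zero = 0, add = (+)\<rparr>"

lemma ring_free_alg_ring: "ring (free_alg_ring :: ('a, 'k::comm_ring_1) free_alg ring)"
proof (rule ringI)
  show "abelian_group (free_alg_ring :: ('a, 'k) free_alg ring)"
  proof (rule abelian_groupI)
    fix x :: "('a, 'k) free_alg"
    assume "x \<in> carrier free_alg_ring"
    show "\<exists>y\<in>carrier free_alg_ring. y \<oplus>\<^bsub>free_alg_ring\<^esub> x = \<zero>\<^bsub>free_alg_ring\<^esub>"
      by (rule bexI[of _ "- x"]) (simp_all add: free_alg_ring_def)
  qed (simp_all add: free_alg_ring_def algebra_simps)
  show "monoid (free_alg_ring :: ('a, 'k) free_alg ring)"
    by (rule monoidI) (simp_all add: free_alg_ring_def algebra_simps)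
qed (simp_all add: free_alg_ring_def algebra_simps)


section \<open>The reflection equation algebra of rank 2\<close>

datatype gen = U11 | U12 | U21 | U22

definition rea_relators :: "'k::field \<Rightarrow> (gen, 'k) free_alg set" where
  "rea_relators q =
    (let u11 = fvar U11; u12 = fvar U12; u21 = fvar U21; u22 = fvar U22;
         Q = fconst (q ^ 2); P = fconst (inverse (q ^ 2) - 1)
     in {u11 * u22 - u22 * u11,
         u22 * u12 - Q * u12 * u22,
         u21 * u22 - Q * u22 * u21,
         u11 * u12 - u12 * (u11 + P * u22),
         u21 * u11 - (u11 + P * u22) * u21,
         (u21 * u12 - u12 * u21) - P * u22 * (u22 - u11)})"

definition rea_ideal :: "'k::field \<Rightarrow> (gen, 'k) free_alg set"
  where "rea_ideal q = genideal free_alg_ring (rea_relators q)"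

type_synonym 'k rea = "(gen, 'k) free_alg set"

definition Aq :: "'k::field \<Rightarrow> 'k rea ring"
  where "Aq q = free_alg_ring Quot rea_ideal q"

definition gen_u :: "'k::field \<Rightarrow> gen \<Rightarrow> 'k rea"
  where "gen_u q g = rea_ideal q +>\<^bsub>free_alg_ring\<^esub> fvar g"

definition scal :: "'k::field \<Rightarrow> 'k \<Rightarrow> 'k rea"
  where "scal q c = rea_ideal q +>\<^bsub>free_alg_ring\<^esub> fconst c"

lemma ideal_rea_ideal: "ideal (rea_ideal q) free_alg_ring"
  unfolding rea_ideal_def
  by (rule ring.genideal_ideal[OF ring_free_alg_ring]) (simp add: free_alg_ring_def)

lemma ring_Aq: "ring (Aq q)"
  unfolding Aq_def by (rule ideal.quotient_is_ring[OF ideal_rea_ideal])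

lemma gen_u_closed: "gen_u q g \<in> carrier (Aq q)"
  and scal_closed: "scal q c \<in> carrier (Aq q)"
  by (auto simp: gen_u_def scal_def Aq_def FactRing_def A_RCOSETS_def' free_alg_ring_def)


section \<open>Right modules\<close>

text \<open>
  The library's module locale covers modules over commutative rings only.  As there, just the
  additive part of the underlying ring record of a module is used; \<open>mult\<close> and \<open>one\<close> are irrelevant.
\<close>

record ('r, 'm) rmodule = "'m ring" +
  ract :: "'m \<Rightarrow> 'r \<Rightarrow> 'm" (infixl \<open>\<triangleleft>\<index>\<close> 70)

locale right_module = R?: ring R + M?: abelian_group M
  for R :: "('r, 'x) ring_scheme" (structure)
    and M :: "('r, 'm, 'y) rmodule_scheme" (structure) +
  assumes ract_closed [simp, intro]:
      "\<lbrakk>x \<in> carrier M; a \<in> carrier R\<rbrakk> \<Longrightarrow> x \<triangleleft>\<^bsub>M\<^esub> a \<in> carrier M"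
    and ract_add_left:
      "\<lbrakk>x \<in> carrier M; y \<in> carrier M; a \<in> carrier R\<rbrakk>
        \<Longrightarrow> (x \<oplus>\<^bsub>M\<^esub> y) \<triangleleft>\<^bsub>M\<^esub> a = x \<triangleleft>\<^bsub>M\<^esub> a \<oplus>\<^bsub>M\<^esub> y \<triangleleft>\<^bsub>M\<^esub> a"
    and ract_add_right:
      "\<lbrakk>x \<in> carrier M; a \<in> carrier R; b \<in> carrier R\<rbrakk>
        \<Longrightarrow> x \<triangleleft>\<^bsub>M\<^esub> (a \<oplus>\<^bsub>R\<^esub> b) = x \<triangleleft>\<^bsub>M\<^esub> a \<oplus>\<^bsub>M\<^esub> x \<triangleleft>\<^bsub>M\<^esub> b"
    and ract_mult:
      "\<lbrakk>x \<in> carrier M; a \<in> carrier R; b \<in> carrier R\<rbrakk>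
        \<Longrightarrow> x \<triangleleft>\<^bsub>M\<^esub> (a \<otimes>\<^bsub>R\<^esub> b) = (x \<triangleleft>\<^bsub>M\<^esub> a) \<triangleleft>\<^bsub>M\<^esub> b"
    and ract_one [simp]:
      "x \<in> carrier M \<Longrightarrow> x \<triangleleft>\<^bsub>M\<^esub> \<one>\<^bsub>R\<^esub> = x"

definition right_submodule ::
    "('r, 'x) ring_scheme \<Rightarrow> ('r, 'm, 'y) rmodule_scheme \<Rightarrow> 'm set \<Rightarrow> bool" where
  "right_submodule R M S \<longleftrightarrow>
     additive_subgroup S M \<and> (\<forall>x\<in>S. \<forall>a\<in>carrier R. x \<triangleleft>\<^bsub>M\<^esub> a \<in> S)"

definition simple_right_module ::
    "('r, 'x) ring_scheme \<Rightarrow> ('r, 'm, 'y) rmodule_scheme \<Rightarrow> bool" where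
  "simple_right_module R M \<longleftrightarrow>
     right_module R M \<and> carrier M \<noteq> {\<zero>\<^bsub>M\<^esub>} \<and>
     (\<forall>S. right_submodule R M S \<longrightarrow> S = {\<zero>\<^bsub>M\<^esub>} \<or> S = carrier M)"

definition right_module_iso ::
    "('r, 'x) ring_scheme \<Rightarrow> ('r, 'm, 'y) rmodule_scheme \<Rightarrow> ('r, 'n, 'z) rmodule_scheme \<Rightarrow> bool"
  where
  "right_module_iso R M N \<longleftrightarrow>
     (\<exists>f. bij_betw f (carrier M) (carrier N) \<and>
          (\<forall>x\<in>carrier M. \<forall>y\<in>carrier M. f (x \<oplus>\<^bsub>M\<^esub> y) = f x \<oplus>\<^bsub>N\<^esub> f y) \<and>
          (\<forall>x\<in>carrier M. \<forall>a\<in>carrier R. f (x \<triangleleft>\<^bsub>M\<^esub> a) = f x \<triangleleft>\<^bsub>N\<^esub> a))"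

definition torsionfree_wrt ::
    "('r, 'x) ring_scheme \<Rightarrow> ('r, 'm, 'y) rmodule_scheme \<Rightarrow> 'r \<Rightarrow> bool" where
  "torsionfree_wrt R M a \<longleftrightarrow>
     (\<forall>x\<in>carrier M. \<forall>i::nat. x \<triangleleft>\<^bsub>M\<^esub> (a [^]\<^bsub>R\<^esub> i) = \<zero>\<^bsub>M\<^esub> \<longrightarrow> x = \<zero>\<^bsub>M\<^esub>)"


section \<open>The simple modules of types \<open>N\<^sub>1\<close>, \<open>N\<^sub>2\<close>, \<open>N\<^sub>3\<close>\<close>

definition primitive_root_of_unity :: "nat \<Rightarrow> 'k::field \<Rightarrow> bool" where
  "primitive_root_of_unity m q \<longleftrightarrow> m > 0 \<and> q ^ m = 1 \<and> (\<forall>k. 0 < k \<and> k < m \<longrightarrow> q ^ k \<noteq> 1)"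

definition n_of :: "nat \<Rightarrow> nat"
  where "n_of m = (if odd m then m else m div 2)"

text \<open>The \<open>K\<close>-vector space structure of a module is the one induced by \<^const>\<open>scal\<close>.\<close>

definition is_K_basis ::
    "'k::field \<Rightarrow> ('k rea, 'm) rmodule \<Rightarrow> nat \<Rightarrow> (nat \<Rightarrow> 'm) \<Rightarrow> bool" where
  "is_K_basis q M d b \<longleftrightarrow>
     (\<forall>r<d. b r \<in> carrier M) \<and>
     (\<forall>x\<in>carrier M. \<exists>!c. c \<in> {..<d} \<rightarrow>\<^sub>E UNIV \<and>
        x = (\<Oplus>\<^bsub>M\<^esub>r\<in>{..<d}. b r \<triangleleft>\<^bsub>M\<^esub> scal q (c r)))"

definition c_coeff :: "'k::field \<Rightarrow> 'k \<Rightarrow> 'k \<Rightarrow> 'k \<Rightarrow> nat \<Rightarrow> 'k" where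
  "c_coeff q l1 l2 l3 r =
     l3 + inverse (q ^ 2) * (q ^ (2 * r) - 1) * l1 * l2
        + (q ^ (2 * r) - q ^ (4 * r)) * inverse (q ^ 4) * l2 ^ 2"

definition c'_coeff :: "'k::field \<Rightarrow> 'k \<Rightarrow> 'k \<Rightarrow> nat \<Rightarrow> 'k" where
  "c'_coeff q l1 l2 r =
     inverse (q ^ 2) * (q ^ (2 * r) - 1) * l1 * l2
        + (q ^ (2 * r) - q ^ (4 * r)) * inverse (q ^ 4) * l2 ^ 2"

definition type_N1 :: "'k::field \<Rightarrow> nat \<Rightarrow> ('k rea, 'm) rmodule \<Rightarrow> bool" where
  "type_N1 q n M \<longleftrightarrow>
     simple_right_module (Aq q) M \<and>
     (\<exists>\<alpha> \<beta> l1 l2 l3. \<beta> \<noteq> 0 \<and> l2 \<noteq> 0 \<and>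
       (\<exists>v\<in>carrier M. v \<noteq> \<zero>\<^bsub>M\<^esub> \<and>
         (let u11 = gen_u q U11; u12 = gen_u q U12; u21 = gen_u q U21; u22 = gen_u q U22;
              b = (\<lambda>r::nat. v \<triangleleft>\<^bsub>M\<^esub> (u21 [^]\<^bsub>Aq q\<^esub> r))
          in
            v \<triangleleft>\<^bsub>M\<^esub> (u12 [^]\<^bsub>Aq q\<^esub> n) = v \<triangleleft>\<^bsub>M\<^esub> scal q \<alpha> \<and>
            v \<triangleleft>\<^bsub>M\<^esub> (u21 [^]\<^bsub>Aq q\<^esub> n) = v \<triangleleft>\<^bsub>M\<^esub> scal q \<beta> \<and>
            v \<triangleleft>\<^bsub>M\<^esub> u11 = v \<triangleleft>\<^bsub>M\<^esub> scal q l1 \<and>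
            v \<triangleleft>\<^bsub>M\<^esub> u22 = v \<triangleleft>\<^bsub>M\<^esub> scal q l2 \<and>
            v \<triangleleft>\<^bsub>M\<^esub> (u12 \<otimes>\<^bsub>Aq q\<^esub> u21) = v \<triangleleft>\<^bsub>M\<^esub> scal q l3 \<and>
            is_K_basis q M n b \<and>
            (\<forall>r<n. b r \<triangleleft>\<^bsub>M\<^esub> u11 =
                     b r \<triangleleft>\<^bsub>M\<^esub> scal q (l1 + inverse (q ^ 2) * (1 - q ^ (2 * r)) * l2)) \<and>
            (\<forall>r. 1 \<le> r \<and> r < n \<longrightarrow>
                     b r \<triangleleft>\<^bsub>M\<^esub> u12 = b (r - 1) \<triangleleft>\<^bsub>M\<^esub> scal q (c_coeff q l1 l2 l3 r)) \<and>
            v \<triangleleft>\<^bsub>M\<^esub> u12 = b (n - 1) \<triangleleft>\<^bsub>M\<^esub> scal q (inverse \<beta> * l3) \<and>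
            (\<forall>r. r + 1 < n \<longrightarrow> b r \<triangleleft>\<^bsub>M\<^esub> u21 = b (r + 1)) \<and>
            b (n - 1) \<triangleleft>\<^bsub>M\<^esub> u21 = v \<triangleleft>\<^bsub>M\<^esub> scal q \<beta> \<and>
            (\<forall>r<n. b r \<triangleleft>\<^bsub>M\<^esub> u22 = b r \<triangleleft>\<^bsub>M\<^esub> scal q (q ^ (2 * r) * l2)))))"

definition type_N2 :: "'k::field \<Rightarrow> nat \<Rightarrow> ('k rea, 'm) rmodule \<Rightarrow> bool" where
  "type_N2 q n M \<longleftrightarrow>
     simple_right_module (Aq q) M \<and>
     (\<exists>\<alpha> l1 l2 l3. \<alpha> \<noteq> 0 \<and> l2 \<noteq> 0 \<and>
       (\<exists>v\<in>carrier M. v \<noteq> \<zero>\<^bsub>M\<^esub> \<and>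
         (let u11 = gen_u q U11; u12 = gen_u q U12; u21 = gen_u q U21; u22 = gen_u q U22
          in
            v \<triangleleft>\<^bsub>M\<^esub> (u12 [^]\<^bsub>Aq q\<^esub> n) = v \<triangleleft>\<^bsub>M\<^esub> scal q \<alpha> \<and>
            v \<triangleleft>\<^bsub>M\<^esub> (u21 [^]\<^bsub>Aq q\<^esub> n) = \<zero>\<^bsub>M\<^esub> \<and>
            v \<triangleleft>\<^bsub>M\<^esub> u11 = v \<triangleleft>\<^bsub>M\<^esub> scal q l1 \<and>
            v \<triangleleft>\<^bsub>M\<^esub> u22 = v \<triangleleft>\<^bsub>M\<^esub> scal q l2 \<and>
            v \<triangleleft>\<^bsub>M\<^esub> (u12 \<otimes>\<^bsub>Aq q\<^esub> u21) = v \<triangleleft>\<^bsub>M\<^esub> scal q l3 \<and>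
            is_K_basis q M n (\<lambda>r. v \<triangleleft>\<^bsub>M\<^esub> (u12 [^]\<^bsub>Aq q\<^esub> r)))))"

definition type_N3 :: "'k::field \<Rightarrow> nat \<Rightarrow> ('k rea, 'm) rmodule \<Rightarrow> bool" where
  "type_N3 q n M \<longleftrightarrow>
     simple_right_module (Aq q) M \<and>
     (\<forall>x\<in>carrier M. x \<triangleleft>\<^bsub>M\<^esub> (gen_u q U12 [^]\<^bsub>Aq q\<^esub> n) = \<zero>\<^bsub>M\<^esub>) \<and>
     (\<forall>x\<in>carrier M. x \<triangleleft>\<^bsub>M\<^esub> (gen_u q U21 [^]\<^bsub>Aq q\<^esub> n) = \<zero>\<^bsub>M\<^esub>) \<and>
     (\<exists>l1 l2 s. l2 \<noteq> 0 \<and>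
       (\<exists>w\<in>carrier M. w \<noteq> \<zero>\<^bsub>M\<^esub> \<and>
         (let u11 = gen_u q U11; u12 = gen_u q U12; u21 = gen_u q U21; u22 = gen_u q U22;
              b = (\<lambda>r::nat. w \<triangleleft>\<^bsub>M\<^esub> (u21 [^]\<^bsub>Aq q\<^esub> r))
          in
            w \<triangleleft>\<^bsub>M\<^esub> u12 = \<zero>\<^bsub>M\<^esub> \<and>
            w \<triangleleft>\<^bsub>M\<^esub> u11 = w \<triangleleft>\<^bsub>M\<^esub> scal q l1 \<and>
            w \<triangleleft>\<^bsub>M\<^esub> u22 = w \<triangleleft>\<^bsub>M\<^esub> scal q l2 \<and>
            1 \<le> s \<and> s \<le> n \<and> b s = \<zero>\<^bsub>M\<^esub> \<and> (\<forall>t. 1 \<le> t \<and> t < s \<longrightarrow> b t \<noteq> \<zero>\<^bsub>M\<^esub>) \<and>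
            (if \<exists>t\<in>{1..<n}. l1 = q ^ (2 * t - 2) * l2
             then s \<in> {1..<n} \<and> l1 = q ^ (2 * s - 2) * l2
             else s = n) \<and>
            is_K_basis q M s b \<and>
            (\<forall>r<s. b r \<triangleleft>\<^bsub>M\<^esub> u11 =
                     b r \<triangleleft>\<^bsub>M\<^esub> scal q (l1 + inverse (q ^ 2) * (1 - q ^ (2 * r)) * l2)) \<and>
            (\<forall>r. 1 \<le> r \<and> r < s \<longrightarrow>
                     b r \<triangleleft>\<^bsub>M\<^esub> u12 = b (r - 1) \<triangleleft>\<^bsub>M\<^esub> scal q (c'_coeff q l1 l2 r)) \<and>
            (\<forall>r. r + 1 < s \<longrightarrow> b r \<triangleleft>\<^bsub>M\<^esub> u21 = b (r + 1)) \<and>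
            b (s - 1) \<triangleleft>\<^bsub>M\<^esub> u21 = \<zero>\<^bsub>M\<^esub> \<and>
            (\<forall>r<s. b r \<triangleleft>\<^bsub>M\<^esub> u22 = b r \<triangleleft>\<^bsub>M\<^esub> scal q (q ^ (2 * r) * l2)))))"

end

theory Submission
  imports Defs
begin

text \<open>
  Write \<open>x = u\<^sub>2\<^sub>1\<close>, \<open>y = u\<^sub>1\<^sub>2\<close>, \<open>t = u\<^sub>2\<^sub>2\<close>.  Together with the quantum trace \<open>T\<close> and determinant \<open>D\<close>,
  the powers \<open>x\<^sup>n\<close>, \<open>y\<^sup>n\<close>, \<open>t\<^sup>n\<close> are central, and the algebra is finitely generated over the subring
  these five elements generate.  By Nakayama's lemma and the Nullstellensatz they act by scalars on
  a simple module, so \<open>t\<close> has an eigenvector, with nonzero eigenvalue by torsionfreeness.  As \<open>xy\<close> and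
  \<open>yx\<close> are polynomials in \<open>T\<close>, \<open>D\<close>, \<open>t\<close>, the powers of \<open>x\<close> (or of \<open>y\<close>) applied to it span a submodule,
  and their \<open>t\<close>-eigenvalues are distinct.  The three types correspond to \<open>x\<^sup>n \<noteq> 0\<close>, to \<open>x\<^sup>n = 0 \<noteq> y\<^sup>n\<close>, and to
  \<open>x\<^sup>n = y\<^sup>n = 0\<close>, where one starts from a \<open>t\<close>-eigenvector killed by \<open>y\<close>.
\<close>

section \<open>Points of polynomial rings\<close>

text \<open>This is why the five central elements are treated together: they make the module one
  over a polynomial ring in five variables, its annihilator there is a prime, and a point of that
  prime supplies all scalars at once. The Nullstellensatz needed for this is proved one variable at
  a time, for iterated univariate polynomial rings. The trace \<open>T\<close> serves to eliminate
  \<open>u11\<close>, the determinant \<open>D\<close> to evaluate the products of \<open>x\<close>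
  and \<open>y\<close>. Passing \<open>x\<close> multiplies a \<open>t\<close>-eigenvalue by
  \<open>q ^ 2\<close>, passing \<open>y\<close> divides it by \<open>q ^ 2\<close>; so
  \<open>n\<close>, the order of \<open>q ^ 2\<close>, is both the number of distinct eigenvalues in
  a chain and the exponent that makes the powers central. Every nonzero vector generates a simple
  module, so changing the starting vector only means changing the right ideal \<open>J\<close>, its
  annihilator.\<close>

lemma infinite_alg_closed_field: "infinite (UNIV :: 'k::alg_closed_field set)"
proof
  assume fin: "finite (UNIV :: 'k set)"
  define p :: "'k poly" where "p = (\<Prod>a\<in>UNIV. [:- a, 1:]) + 1"
  have "degree (\<Prod>a\<in>(UNIV::'k set). [:- a, 1:]) = card (UNIV :: 'k set)"
    using fin by (subst degree_prod_sum_eq) auto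
  moreover have "card (UNIV :: 'k set) > 0"
    using fin by (simp add: card_gt_0_iff)
  ultimately have "degree p > 0"
    unfolding p_def by (subst degree_add_eq_left) auto
  then obtain x where "poly p x = 0"
    using alg_closed_imp_poly_has_root by blast
  moreover have "poly p x = 1"
    unfolding p_def using fin by (auto simp: poly_prod prod_zero_iff)
  ultimately show False by simp
qed

lemma alg_closed_nonroot:
  fixes p :: "'k::alg_closed_field poly"
  assumes "p \<noteq> 0"
  obtains x where "poly p x \<noteq> 0"
proof -
  have "{x. poly p x = 0} \<noteq> UNIV"
    using poly_roots_finite[OF assms] infinite_alg_closed_field by auto
  then show ?thesis using that by auto
qed

text \<open>Congruence modulo a two-sided ideal, kept as a relation on the ring itself: the quotients
  that occur depend on term parameters and hence are not types.\<close>

locale ideal_cong =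
  fixes I :: "'a::ring_1 set"
  assumes zero_mem: "0 \<in> I"
    and add_mem: "a \<in> I \<Longrightarrow> b \<in> I \<Longrightarrow> a + b \<in> I"
    and lmult_mem: "a \<in> I \<Longrightarrow> c * a \<in> I"
    and rmult_mem: "a \<in> I \<Longrightarrow> a * c \<in> I"
begin

definition eqm :: "'a \<Rightarrow> 'a \<Rightarrow> bool" (infix \<open>\<approx>\<close> 50)
  where "a \<approx> b \<longleftrightarrow> a - b \<in> I"

lemma uminus_mem: "a \<in> I \<Longrightarrow> - a \<in> I"
  using lmult_mem[of a "-1"] by simp

lemma diff_mem: "a \<in> I \<Longrightarrow> b \<in> I \<Longrightarrow> a - b \<in> I"
  using add_mem[OF _ uminus_mem] by fastforce

lemma eqm_refl [simp]: "a \<approx> a"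
  by (simp add: eqm_def zero_mem)

lemma eqm_sym: "a \<approx> b \<Longrightarrow> b \<approx> a"
  using uminus_mem[of "a - b"] by (simp add: eqm_def)

lemma eqm_trans [trans]: "a \<approx> b \<Longrightarrow> b \<approx> c \<Longrightarrow> a \<approx> c"
  using add_mem[of "a - b" "b - c"] by (simp add: eqm_def)

lemma eqm_add: "a \<approx> b \<Longrightarrow> c \<approx> d \<Longrightarrow> a + c \<approx> b + d"
  using add_mem[of "a - b" "c - d"] by (simp add: eqm_def algebra_simps)

lemma eqm_uminus: "a \<approx> b \<Longrightarrow> - a \<approx> - b"
  using uminus_mem[of "a - b"] by (simp add: eqm_def)

lemma eqm_diff: "a \<approx> b \<Longrightarrow> c \<approx> d \<Longrightarrow> a - c \<approx> b - d"
  using eqm_add[OF _ eqm_uminus, of a b c d] by simp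

lemma eqm_mult: "a \<approx> b \<Longrightarrow> c \<approx> d \<Longrightarrow> a * c \<approx> b * d"
proof -
  assume "a \<approx> b" "c \<approx> d"
  then have "(a - b) * c + b * (c - d) \<in> I"
    unfolding eqm_def by (intro add_mem lmult_mem[of "c - d"] rmult_mem[of "a - b"])
  then show ?thesis by (simp add: eqm_def algebra_simps)
qed

lemma eqm_lmult: "a \<approx> b \<Longrightarrow> c * a \<approx> c * b"
  by (rule eqm_mult) auto

lemma eqm_rmult: "a \<approx> b \<Longrightarrow> a * c \<approx> b * c"
  by (rule eqm_mult) auto

lemma eqm_power: "a \<approx> b \<Longrightarrow> a ^ n \<approx> b ^ n"
  by (induction n) (auto intro: eqm_mult)

lemma eqm_sum: "(\<And>i. i \<in> A \<Longrightarrow> f i \<approx> g i) \<Longrightarrow> sum f A \<approx> sum g A"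
  by (induction A rule: infinite_finite_induct) (auto intro: eqm_add)

definition comm :: "'a \<Rightarrow> 'a \<Rightarrow> bool"
  where "comm a b \<longleftrightarrow> a * b \<approx> b * a"

lemma comm_sym: "comm a b \<Longrightarrow> comm b a"
  by (simp add: comm_def eqm_sym)

lemma comm_refl [simp]: "comm a a" and comm_0 [simp]: "comm a 0" "comm 0 a"
  and comm_1 [simp]: "comm a 1" "comm 1 a"
  by (simp_all add: comm_def)

lemma comm_add: "comm a b \<Longrightarrow> comm a c \<Longrightarrow> comm a (b + c)"
  unfolding comm_def distrib_left distrib_right by (rule eqm_add)

lemma comm_diff: "comm a b \<Longrightarrow> comm a c \<Longrightarrow> comm a (b - c)"
  unfolding comm_def left_diff_distrib right_diff_distrib by (rule eqm_diff)

lemma comm_mult: "comm a b \<Longrightarrow> comm a c \<Longrightarrow> comm a (b * c)"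
proof -
  assume "comm a b" "comm a c"
  then have "(a * b) * c \<approx> (b * a) * c" "b * (a * c) \<approx> b * (c * a)"
    by (auto simp: comm_def intro: eqm_lmult eqm_rmult)
  then show ?thesis unfolding comm_def using eqm_trans by (simp add: mult.assoc)
qed

lemma comm_power: "comm a b \<Longrightarrow> comm a (b ^ n)"
  by (induction n) (auto intro: comm_mult)

text \<open>Zero is preserved exactly, while the other laws hold only up to congruence:
  \<open>pCons 0 0\<close> is the zero polynomial, so the Horner recursion
  \<open>horner_pCons\<close> is consistent only if \<open>f 0\<close> is equal to 0.\<close>

definition hom_mod :: "('s::comm_ring_1 \<Rightarrow> 'a) \<Rightarrow> bool"
  where "hom_mod f \<longleftrightarrow> f 0 = 0 \<and> f 1 \<approx> 1 \<and> (\<forall>a b. f (a + b) \<approx> f a + f b) \<and>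
    (\<forall>a b. f (a * b) \<approx> f a * f b)"

lemma hom_modD:
  assumes "hom_mod f"
  shows "f 0 = 0" "f 1 \<approx> 1" "f (a + b) \<approx> f a + f b" "f (a * b) \<approx> f a * f b"
  using assms by (auto simp: hom_mod_def)

lemma hom_mod_uminus:
  assumes "hom_mod f"
  shows "f (- a) \<approx> - f a"
proof -
  have "f (- a + a) \<approx> f (- a) + f a"
    using hom_modD(3)[OF assms] .
  then show ?thesis
    using hom_modD(1)[OF assms] eqm_sym by (fastforce simp: eqm_def)
qed

lemma hom_mod_diff:
  assumes "hom_mod f"
  shows "f (a - b) \<approx> f a - f b"
proof -
  have "f (a + - b) \<approx> f a + f (- b)" by (rule hom_modD(3)[OF assms])
  also have "\<dots> \<approx> f a + - f b" by (intro eqm_add hom_mod_uminus assms eqm_refl)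
  finally show ?thesis by simp
qed

lemma hom_mod_power:
  assumes "hom_mod f"
  shows "f (a ^ n) \<approx> f a ^ n"
proof (induction n)
  case (Suc n)
  have "f (a * a ^ n) \<approx> f a * f (a ^ n)" by (rule hom_modD(4)[OF assms])
  also have "\<dots> \<approx> f a * f a ^ n" by (rule eqm_lmult[OF Suc.IH])
  finally show ?case by simp
qed (simp add: hom_modD(2)[OF assms])

end

text \<open>Evaluation at \<open>z\<close> of a polynomial whose coefficients are mapped by \<open>f\<close>, by Horner's rule;
  unlike the library's evaluation it takes values in a noncommutative ring.\<close>

definition horner :: "('s::zero \<Rightarrow> 'a::ring_1) \<Rightarrow> 'a \<Rightarrow> 's poly \<Rightarrow> 'a"
  where "horner f z p = fold_coeffs (\<lambda>c r. f c + z * r) p 0"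

lemma horner_0 [simp]: "horner f z 0 = 0"
  by (simp add: horner_def)

lemma horner_pCons: "f 0 = 0 \<Longrightarrow> horner f z (pCons c p) = f c + z * horner f z p"
  by (cases "p = 0 \<and> c = 0") (auto simp: horner_def)

lemma horner_const: "f 0 = 0 \<Longrightarrow> horner f z [:c:] = f c"
  by (simp add: horner_pCons)

lemma horner_eq_poly:
  fixes f :: "'s::zero \<Rightarrow> 'k::comm_ring_1"
  assumes "f 0 = 0"
  shows "horner f z p = poly (map_poly f p) z"
  by (induction p) (auto simp: horner_pCons map_poly_pCons assms)

context ideal_cong
begin

lemma comm_horner:
  assumes "f 0 = 0" "\<And>c. comm a (f c)" "comm a z"
  shows "comm a (horner f z p)"
  by (induction p) (auto simp: horner_pCons assms intro!: comm_add comm_mult)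

text \<open>Products cause the only difficulty: a coefficient \<open>f a\<close> has to be moved to
  the left of \<open>z\<close>. The images of the coefficients commute with one another modulo the
  ideal because their source is commutative.\<close>

lemma hom_mod_horner:
  assumes f: "hom_mod f" and z: "\<And>c. comm z (f c)"
  shows "hom_mod (horner f z)"
proof -
  note f0 = hom_modD(1)[OF f]
  have smult: "horner f z (smult a p) \<approx> f a * horner f z p" for a p
  proof (induction p)
    case (pCons b p)
    have "horner f z (smult a (pCons b p)) = f (a * b) + z * horner f z (smult a p)"
      by (simp add: horner_pCons f0)
    also have "\<dots> \<approx> f a * f b + z * (f a * horner f z p)"
      by (intro eqm_add hom_modD(4)[OF f] eqm_lmult pCons.IH)
    also have "\<dots> = f a * f b + (z * f a) * horner f z p"
      by (simp add: mult.assoc)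
    also have "\<dots> \<approx> f a * f b + (f a * z) * horner f z p"
      by (intro eqm_add eqm_rmult eqm_refl z[unfolded comm_def])
    also have "\<dots> = f a * horner f z (pCons b p)"
      by (simp add: horner_pCons f0 algebra_simps)
    finally show ?case .
  qed auto
  have add: "horner f z (p + r) \<approx> horner f z p + horner f z r" for p r
  proof (induction p r rule: poly_induct2)
    case (pCons a p b r)
    have "horner f z (pCons a p + pCons b r) = f (a + b) + z * horner f z (p + r)"
      by (simp add: horner_pCons f0)
    also have "\<dots> \<approx> (f a + f b) + z * (horner f z p + horner f z r)"
      by (intro eqm_add hom_modD(3)[OF f] eqm_lmult pCons.IH)
    finally show ?case by (simp add: horner_pCons f0 algebra_simps)
  qed auto
  have mult: "horner f z (p * r) \<approx> horner f z p * horner f z r" for p r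
  proof (induction p)
    case (pCons a p)
    have "horner f z (pCons a p * r) = horner f z (smult a r + pCons 0 (p * r))"
      by simp
    also have "\<dots> \<approx> horner f z (smult a r) + horner f z (pCons 0 (p * r))"
      by (rule add)
    also have "\<dots> \<approx> f a * horner f z r + z * (horner f z p * horner f z r)"
      by (simp add: horner_pCons f0) (intro eqm_add eqm_lmult smult pCons.IH)
    finally show ?case by (simp add: horner_pCons f0 algebra_simps)
  qed auto
  have "horner f z 1 \<approx> 1"
    using hom_modD(2)[OF f] by (simp add: one_pCons horner_const f0)
  then show ?thesis
    unfolding hom_mod_def using add mult by simp
qed

lemma horner_X:
  assumes "hom_mod f"
  shows "horner f z [:0, 1:] \<approx> z"
  using eqm_lmult[OF hom_modD(2)[OF assms], of z] by (simp add: horner_pCons hom_modD(1)[OF assms])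

end

section \<open>Points and prime ideals of commutative rings\<close>

definition ring_map :: "('s::comm_ring_1 \<Rightarrow> 'k::field) \<Rightarrow> bool"
  where "ring_map f \<longleftrightarrow> f 0 = 0 \<and> f 1 = 1 \<and> (\<forall>a b. f (a + b) = f a + f b) \<and>
    (\<forall>a b. f (a * b) = f a * f b)"

text \<open>Modulo the zero ideal congruence is equality, so the Horner lemmas also extend
  field-valued points from a ring to its polynomial ring.\<close>

interpretation zero_cong: ideal_cong "{0 :: 'a::ring_1}"
  by standard auto

lemma ring_map_iff: "ring_map f \<longleftrightarrow> zero_cong.hom_mod f"
  by (auto simp: ring_map_def zero_cong.hom_mod_def zero_cong.eqm_def)

lemma ring_mapD:
  assumes "ring_map f"
  shows "f 0 = 0" "f 1 = 1" "f (a + b) = f a + f b" "f (a * b) = f a * f b"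
    "f (a ^ n) = f a ^ n" "f (a - b) = f a - f b"
proof -
  have h: "zero_cong.hom_mod f" using assms ring_map_iff by blast
  show "f (a ^ n) = f a ^ n" "f (a - b) = f a - f b"
    using zero_cong.hom_mod_power[OF h] zero_cong.hom_mod_diff[OF h]
    by (auto simp: zero_cong.eqm_def)
qed (use assms in \<open>auto simp: ring_map_def\<close>)

lemma ring_map_horner: "ring_map f \<Longrightarrow> ring_map (horner f z)"
  unfolding ring_map_iff
  by (rule zero_cong.hom_mod_horner) (auto simp: zero_cong.comm_def zero_cong.eqm_def)

definition prime_set :: "'s::comm_ring_1 set \<Rightarrow> bool"
  where "prime_set P \<longleftrightarrow> 0 \<in> P \<and> (\<forall>a\<in>P. \<forall>b\<in>P. a + b \<in> P) \<and> (\<forall>a. \<forall>b\<in>P. a * b \<in> P) \<and>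
    1 \<notin> P \<and> (\<forall>a b. a * b \<in> P \<longrightarrow> a \<in> P \<or> b \<in> P)"

lemma prime_setD:
  assumes "prime_set P"
  shows "0 \<in> P" "a \<in> P \<Longrightarrow> b \<in> P \<Longrightarrow> a + b \<in> P" "b \<in> P \<Longrightarrow> a * b \<in> P" "b \<in> P \<Longrightarrow> b * a \<in> P"
    "1 \<notin> P" "a * b \<in> P \<Longrightarrow> a \<in> P \<or> b \<in> P" "a \<in> P \<Longrightarrow> b \<in> P \<Longrightarrow> a - b \<in> P"
    "a ^ n \<in> P \<Longrightarrow> a \<in> P"
proof -
  have mult: "\<And>a b. b \<in> P \<Longrightarrow> a * b \<in> P" and add: "\<And>a b. a \<in> P \<Longrightarrow> b \<in> P \<Longrightarrow> a + b \<in> P"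
    using assms by (auto simp: prime_set_def)
  show "a \<in> P \<Longrightarrow> b \<in> P \<Longrightarrow> a - b \<in> P" using add[of a "-1 * b"] mult[of b "-1"] by simp
  have "a * b \<in> P \<Longrightarrow> a \<in> P \<or> b \<in> P" "1 \<notin> P" for a b
    using assms unfolding prime_set_def by blast+
  then show "a ^ n \<in> P \<Longrightarrow> a \<in> P" by (induction n) auto
  show "b \<in> P \<Longrightarrow> b * a \<in> P" using mult[of b a] by (simp add: mult.commute)
qed (use assms in \<open>auto simp: prime_set_def\<close>)

lemma sum_in_prime:
  assumes "prime_set P" "\<And>i. i \<in> A \<Longrightarrow> f i \<in> P"
  shows "sum f A \<in> P"
  using assms(2) by (induction A rule: infinite_finite_induct) (auto intro: prime_setD[OF assms(1)])

text \<open>The form of the Nullstellensatz that is inherited by \<open>S[X]\<close> from \<open>S\<close>; separating one element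
  from the prime is what makes the induction on the number of variables go through.\<close>

definition separates_primes :: "('k::field \<Rightarrow> 's::comm_ring_1) \<Rightarrow> bool"
  where "separates_primes \<iota> \<longleftrightarrow> (\<forall>P b. prime_set P \<longrightarrow> b \<notin> P \<longrightarrow>
    (\<exists>\<phi>. ring_map \<phi> \<and> (\<forall>c. \<phi> (\<iota> c) = c) \<and> (\<forall>a\<in>P. \<phi> a = 0) \<and> \<phi> b \<noteq> 0))"

lemma separates_primes_field: "separates_primes (\<lambda>c::'k::field. c)"
  unfolding separates_primes_def
proof (intro allI impI)
  fix P and b :: 'k
  assume P: "prime_set P" and b: "b \<notin> P"
  have "a = 0" if "a \<in> P" for a
    using prime_setD(3)[OF P that, of "inverse a"] prime_setD(5)[OF P] by (cases "a = 0") auto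
  moreover have "b \<noteq> 0" using b prime_setD(1)[OF P] by auto
  ultimately show "\<exists>\<phi>. ring_map \<phi> \<and> (\<forall>c. \<phi> c = c) \<and> (\<forall>a\<in>P. \<phi> a = 0) \<and> \<phi> b \<noteq> 0"
    by (intro exI[of _ "\<lambda>c. c"]) (auto simp: ring_map_def)
qed

text \<open>Multiplying the dividend by the leading coefficient of \<open>g\<close> before each
  cancellation avoids inverting it. The bound on \<open>degree w\<close> is used in
  \<open>separates_primes_poly\<close>, where it places a quotient below the degree of
  \<open>g\<close>.\<close>

lemma pseudo_division:
  fixes g h :: "'s::comm_ring_1 poly"
  assumes g: "degree g > 0"
  shows "\<exists>k w r. smult (lead_coeff g ^ k) h = g * w + r \<and> degree r < degree g \<and>
    degree w \<le> degree h - degree g"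
proof (induction "degree h" arbitrary: h rule: less_induct)
  case less
  show ?case
  proof (cases "degree h < degree g")
    case True
    then show ?thesis by (intro exI[of _ 0] exI[of _ 0] exI[of _ h]) auto
  next
    case False
    define n where "n = degree h - degree g"
    define h' where "h' = smult (lead_coeff g) h - g * monom (lead_coeff h) n"
    have "degree (g * monom (lead_coeff h) n) \<le> degree h"
      using degree_mult_le[of g "monom (lead_coeff h) n"] degree_monom_le[of "lead_coeff h" n] False
      by (auto simp: n_def)
    then have "degree h' \<le> degree h"
      unfolding h'_def by (intro degree_diff_le) (auto intro: order.trans[OF degree_smult_le])
    moreover have "coeff (g * monom (lead_coeff h) n) (degree h) = lead_coeff h * lead_coeff g"
      using False by (subst mult.commute) (simp add: n_def coeff_monom_mult)
    then have "coeff h' (degree h) = 0" by (simp add: h'_def mult.commute)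
    ultimately have lt: "degree h' < degree h"
      using g False by (metis leading_coeff_0_iff degree_0 le_neq_implies_less not_less order_less_le_trans)
    obtain k w r where kwr: "smult (lead_coeff g ^ k) h' = g * w + r" "degree r < degree g"
      "degree w \<le> degree h' - degree g"
      using less[OF lt] by blast
    have "smult (lead_coeff g ^ Suc k) h = smult (lead_coeff g ^ k) (h' + g * monom (lead_coeff h) n)"
      by (simp add: h'_def mult.commute)
    also have "\<dots> = g * (w + monom (lead_coeff g ^ k * lead_coeff h) n) + r"
      using kwr(1) by (simp add: smult_add_right distrib_left smult_monom flip: mult_smult_right)
    finally have "smult (lead_coeff g ^ Suc k) h = g * (w + monom (lead_coeff g ^ k * lead_coeff h) n) + r" .
    moreover have "degree (w + monom (lead_coeff g ^ k * lead_coeff h) n) \<le> n"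
      by (intro degree_add_le) (use kwr(3) lt n_def degree_monom_le in auto)
    ultimately show ?thesis using kwr(2) n_def by blast
  qed
qed

text \<open>Over the fraction field of \<open>S/p\<close>, with \<open>p\<close> the contraction of
  \<open>P\<close>, the prime \<open>P\<close> becomes either zero or generated by one polynomial
  \<open>g\<close>; the proof is this dichotomy with denominators cleared. If \<open>P\<close> lies
  in \<open>pX\<close>, a point of \<open>p\<close> that does not kill some coefficient of
  \<open>b\<close> leaves \<open>b\<close> a nonzero polynomial, and a non-root of it is chosen.
  Otherwise \<open>b\<close> has a multiple that modulo \<open>P\<close> is a constant
  \<open>c\<close> outside \<open>p\<close>; a point of \<open>p\<close> not killing
  \<open>a * c\<close> is extended by a root of the image of \<open>g\<close>.\<close>

lemma separates_primes_poly:
  fixes \<iota> :: "'k::alg_closed_field \<Rightarrow> 's::comm_ring_1"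
  assumes sep: "separates_primes \<iota>"
  shows "separates_primes (\<lambda>c. [:\<iota> c:])"
  unfolding separates_primes_def
proof (intro allI impI)
  fix P and b :: "'s poly"
  assume P: "prime_set P" and b: "b \<notin> P"
  define p where "p = {c. [:c:] \<in> P}"
  define pX where "pX = {h. \<forall>i. coeff h i \<in> p}"
  have p: "prime_set p"
    unfolding prime_set_def p_def mem_Collect_eq
  proof (intro conjI ballI allI impI)
    fix a b :: 's
    have eq: "[:a + b:] = [:a:] + [:b:]" "[:a * b:] = [:a:] * [:b:]" by simp_all
    show "[:a:] \<in> P \<or> [:b:] \<in> P" if "[:a * b:] \<in> P"
      using that prime_setD(6)[OF P] unfolding eq by blast
  next
    fix a b :: 's
    assume b: "b \<in> {c. [:c:] \<in> P}"
    have eq: "[:a + b:] = [:a:] + [:b:]" "[:a * b:] = [:a:] * [:b:]" by simp_all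
    show "[:a * b:] \<in> P" using b prime_setD(3)[OF P] unfolding eq by blast
    assume a: "a \<in> {c. [:c:] \<in> P}"
    show "[:a + b:] \<in> P" using a b prime_setD(2)[OF P] unfolding eq by blast
  next
    show "[:0:] \<in> P" "[:1:] \<notin> P" using prime_setD(1,5)[OF P] by (simp_all add: one_pCons)
  qed
  have pX_P: "h \<in> P" if "h \<in> pX" for h
    using that
  proof (induction h)
    case (pCons a h)
    have "a \<in> p" and "h \<in> pX"
      using pCons.prems by (force simp: pX_def coeff_pCons split: nat.splits)+
    then have "[:a:] + [:0, 1:] * h \<in> P"
      using pCons.IH by (intro prime_setD(2,3)[OF P]) (auto simp: p_def)
    then show ?case by simp
  qed (use prime_setD(1)[OF P] in auto)
  have pX_add: "h + h' \<in> pX" if "h \<in> pX" "h' \<in> pX" for h h'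
    using that prime_setD(2)[OF p] by (auto simp: pX_def)
  have truncate: "\<exists>h'. lead_coeff h' \<notin> p \<and> degree h' \<le> degree h \<and> h - h' \<in> pX" if "h \<notin> pX" for h
    using that
  proof (induction "degree h" arbitrary: h rule: less_induct)
    case less
    show ?case
    proof (cases "lead_coeff h \<in> p")
      case False
      then show ?thesis using prime_setD(1)[OF p] by (intro exI[of _ h]) (auto simp: pX_def)
    next
      case True
      define t where "t = monom (lead_coeff h) (degree h)"
      have t: "t \<in> pX" using True prime_setD(1)[OF p] by (auto simp: pX_def t_def)
      have nX: "h - t \<notin> pX"
        using less.prems pX_add[OF _ t, of "h - t"] by auto
      have "degree (h - t) \<le> degree h"
        unfolding t_def by (intro degree_diff_le degree_monom_le) simp
      moreover have "degree (h - t) \<noteq> degree h"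
      proof
        assume eq: "degree (h - t) = degree h"
        have "lead_coeff (h - t) = 0" by (subst eq) (simp add: t_def)
        then have "h - t = 0" by (simp only: leading_coeff_0_iff)
        then show False using nX prime_setD(1)[OF p] by (simp add: pX_def)
      qed
      ultimately have "degree (h - t) < degree h" by simp
      from less.hyps[OF this nX] obtain h' where h': "lead_coeff h' \<notin> p" "degree h' \<le> degree (h - t)"
        "h - t - h' \<in> pX" by blast
      have "h - h' = (h - t - h') + t" by simp
      then have "h - h' \<in> pX" using pX_add[OF h'(3) t] by simp
      then show ?thesis using h' \<open>degree (h - t) < degree h\<close> by (meson less_imp_le order_trans)
    qed
  qed
  have smult_P: "smult c h = [:c:] * h" for c and h :: "'s poly" by simp
  note Pd = prime_setD[OF P] and pd = prime_setD[OF p]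
  show "\<exists>\<phi>. ring_map \<phi> \<and> (\<forall>c. \<phi> [:\<iota> c:] = c) \<and> (\<forall>a\<in>P. \<phi> a = 0) \<and> \<phi> b \<noteq> 0"
  proof (cases "P \<subseteq> pX")
    case True
    from b obtain i where i: "coeff b i \<notin> p" using pX_P by (auto simp: pX_def)
    obtain \<phi> where \<phi>: "ring_map \<phi>" "\<And>c. \<phi> (\<iota> c) = c" "\<And>a. a \<in> p \<Longrightarrow> \<phi> a = 0" "\<phi> (coeff b i) \<noteq> 0"
      using sep p i unfolding separates_primes_def by blast
    note \<phi>0 = ring_mapD(1)[OF \<phi>(1)]
    have "map_poly \<phi> b \<noteq> 0" using \<phi>(4) \<phi>0 by (metis coeff_0 coeff_map_poly)
    then obtain x where x: "poly (map_poly \<phi> b) x \<noteq> 0" by (rule alg_closed_nonroot)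
    have "map_poly \<phi> h = 0" if "h \<in> P" for h
      using that True \<phi>(3) \<phi>0 by (intro poly_eqI) (auto simp: coeff_map_poly pX_def)
    then show ?thesis using x ring_map_horner[OF \<phi>(1), of x] \<phi>(2) \<phi>0
      by (intro exI[of _ "horner \<phi> x"]) (auto simp: horner_eq_poly map_poly_pCons)
  next
    case False
    then obtain g0 where g0: "g0 \<in> P" "g0 \<notin> pX" by auto
    \<comment> \<open>Up to powers of its leading coefficient, \<open>g\<close> generates \<open>P\<close> modulo \<open>pX\<close>.\<close>
    define G where "G = {g \<in> P. lead_coeff g \<notin> p}"
    have trunc_P: "h' \<in> P" if "h \<in> P" "h - h' \<in> pX" for h h'
      using Pd(7)[OF that(1) pX_P[OF that(2)]] by simp
    have "\<exists>g. g \<in> G" using truncate[OF g0(2)] g0(1) trunc_P by (auto simp: G_def)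
    then obtain g where g: "g \<in> G" and gmin: "\<And>h. h \<in> G \<Longrightarrow> degree g \<le> degree h"
      using ex_has_least_nat[of "\<lambda>g. g \<in> G" _ degree] by blast
    define a where "a = lead_coeff g"
    have gP: "g \<in> P" and a: "a \<notin> p" using g by (auto simp: G_def a_def)
    have small_P: "h \<in> pX" if "h \<in> P" "degree h < degree g" for h
    proof (rule ccontr)
      assume "h \<notin> pX"
      then obtain h' where "lead_coeff h' \<notin> p" "degree h' \<le> degree h" "h - h' \<in> pX"
        using truncate[of h] by auto
      then show False using trunc_P[OF that(1)] gmin[of h'] that(2) by (auto simp: G_def)
    qed
    have dg: "degree g > 0"
    proof (rule ccontr)
      assume "\<not> degree g > 0"
      then obtain c where "g = [:c:]" using degree_eq_zeroE[of g] by auto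
      then show False using gP a by (simp add: a_def p_def)
    qed
    \<comment> \<open>A member of \<open>J\<close> of least degree is a constant; points not vanishing at it do not vanish at \<open>b\<close>.\<close>
    define J where "J = {h. lead_coeff h \<notin> p \<and> h \<notin> P \<and> (\<exists>u. h - u * b \<in> P)}"
    have trunc_J: "\<exists>h'\<in>J. degree h' \<le> degree h" if h: "h \<notin> P" "h - u * b \<in> P" for h u
    proof -
      obtain h' where h': "lead_coeff h' \<notin> p" "degree h' \<le> degree h" "h - h' \<in> pX"
        using truncate[of h] pX_P[of h] h(1) by auto
      then have "h' \<notin> P" using h(1) Pd(2)[OF pX_P] by fastforce
      moreover have "h' - u * b \<in> P" using Pd(7)[OF h(2) pX_P[OF h'(3)]] by simp
      ultimately show ?thesis using h' by (auto simp: J_def)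
    qed
    have "\<exists>h. h \<in> J" using trunc_J[of b 1] b Pd(1) by auto
    then obtain e where e: "e \<in> J" and emin: "\<And>h. h \<in> J \<Longrightarrow> degree e \<le> degree h"
      using ex_has_least_nat[of "\<lambda>g. g \<in> J" _ degree] by blast
    have small_J: "h \<in> P" if "h - u * b \<in> P" "degree h < degree e" for h u
      using trunc_J[of h u] that emin by force
    obtain u where u: "e - u * b \<in> P" using e by (auto simp: J_def)
    have eP: "e \<notin> P" and ep: "lead_coeff e \<notin> p" using e by (auto simp: J_def)
    have e_lt: "degree e < degree g"
    proof (rule ccontr)
      assume ge: "\<not> degree e < degree g"
      obtain k w r where k: "smult (a ^ k) e = g * w + r" "degree r < degree g"
        using pseudo_division[OF dg, of e] unfolding a_def by blast
      have r: "r = [:a ^ k:] * e - g * w" using k(1) by simp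
      \<comment> \<open>The remainder of \<open>e\<close> by \<open>g\<close> is again a multiple of
        \<open>b\<close> modulo \<open>P\<close>. Its degree is smaller than that of
        \<open>e\<close>, so it lies in \<open>P\<close>, which would force \<open>a ^ k\<close> or
        \<open>e\<close> into \<open>P\<close>.\<close>
      have "r - ([:a ^ k:] * u) * b = [:a ^ k:] * (e - u * b) - g * w"
        by (simp only: r) (simp only: algebra_simps)
      also have "\<dots> \<in> P" by (rule Pd(7)[OF Pd(3)[OF u] Pd(4)[OF gP]])
      finally have "r \<in> P" using small_J[of r "[:a ^ k:] * u"] k(2) ge by linarith
      then have "[:a ^ k:] * e \<in> P" using Pd(2)[OF _ Pd(4)[OF gP, of w], of r] r by simp
      then have "[:a ^ k:] \<in> P" using Pd(6) eP by blast
      then show False using pd(8) a by (auto simp: p_def)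
    qed
    have "degree e = 0"
    proof (rule ccontr)
      assume "degree e \<noteq> 0"
      then have de: "degree e > 0" by simp
      define l where "l = lead_coeff e"
      \<comment> \<open>Modulo \<open>P\<close> the remainder of \<open>g\<close> by
        \<open>e\<close> is also a multiple of \<open>b\<close>, so minimality of \<open>e\<close>
        puts it in \<open>P\<close>, and its degree puts it in \<open>pX\<close>. Then
        \<open>e * w\<close> is in \<open>P\<close>, hence so is \<open>w\<close>, whose degree is
        below that of \<open>g\<close>; thus \<open>w\<close> is in \<open>pX\<close> as well. All
        coefficients of \<open>l ^ k\<close> times \<open>g\<close> would lie in \<open>p\<close>,
        although \<open>l\<close> and \<open>a\<close> do not.\<close>
      obtain k w r where k: "smult (l ^ k) g = e * w + r" "degree r < degree e" "degree w \<le> degree g - degree e"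
        using pseudo_division[OF de, of g] unfolding l_def by blast
      have r: "r = [:l ^ k:] * g - e * w" using k(1) by simp
      have "r - (- w * u) * b = [:l ^ k:] * g - w * (e - u * b)"
        by (simp only: r) (simp add: algebra_simps)
      also have "\<dots> \<in> P" by (rule Pd(7)[OF Pd(3)[OF gP] Pd(3)[OF u]])
      finally have "r \<in> P" using small_J k(2) by blast
      then have rX: "r \<in> pX" using small_P k(2) e_lt by simp
      have "e * w = [:l ^ k:] * g - r" using k(1) by simp
      then have "e * w \<in> P" using Pd(7)[OF Pd(3)[OF gP] \<open>r \<in> P\<close>] by (simp only:)
      then have "w \<in> P" using Pd(6) eP by blast
      then have wX: "w \<in> pX" using small_P k(3) de dg by simp
      have "coeff (e * w) i \<in> p" for i
        unfolding coeff_mult using wX by (intro sum_in_prime[OF p] pd(3)) (simp add: pX_def)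
      then have "e * w + r \<in> pX" using pX_add[OF _ rX] by (simp add: pX_def)
      then have "coeff (smult (l ^ k) g) (degree g) \<in> p" unfolding k(1) by (simp add: pX_def)
      then have "l ^ k * a \<in> p" by (simp add: a_def)
      then show False using pd(6,8) a ep l_def by blast
    qed
    then obtain c where c: "e = [:c:]" by (metis degree_eq_zeroE)
    have "c \<notin> p" using ep c by simp
    then have "a * c \<notin> p" using a pd(6) by blast
    then obtain \<phi> where \<phi>: "ring_map \<phi>" "\<And>c. \<phi> (\<iota> c) = c" "\<And>a. a \<in> p \<Longrightarrow> \<phi> a = 0" "\<phi> (a * c) \<noteq> 0"
      using sep p unfolding separates_primes_def by blast
    note \<phi>0 = ring_mapD(1)[OF \<phi>(1)]
    have ac: "\<phi> a \<noteq> 0" "\<phi> c \<noteq> 0" using \<phi>(4) ring_mapD(4)[OF \<phi>(1)] by auto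
    \<comment> \<open>Since \<open>\<phi> a\<close> is nonzero, \<open>g\<close> keeps its positive
      degree under \<open>\<phi>\<close>, so its image has a root.\<close>
    have "coeff (map_poly \<phi> g) (degree g) \<noteq> 0" using ac \<phi>0 by (simp add: coeff_map_poly a_def)
    then have "degree (map_poly \<phi> g) > 0" using dg le_degree by (metis less_le_trans)
    then obtain x where x: "poly (map_poly \<phi> g) x = 0" using alg_closed_imp_poly_has_root by blast
    define \<psi> where "\<psi> = horner \<phi> x"
    have \<psi>: "ring_map \<psi>" unfolding \<psi>_def by (rule ring_map_horner[OF \<phi>(1)])
    note \<psi>d = ring_mapD[OF \<psi>]
    have const: "\<psi> [:d:] = \<phi> d" for d by (simp add: \<psi>_def horner_const \<phi>0)
    have X0: "\<psi> h = 0" if "h \<in> pX" for h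
    proof -
      have "map_poly \<phi> h = 0"
        using that \<phi>(3) \<phi>0 by (intro poly_eqI) (auto simp: coeff_map_poly pX_def)
      then show ?thesis by (simp add: \<psi>_def horner_eq_poly \<phi>0)
    qed
    have g0: "\<psi> g = 0" using x by (simp add: \<psi>_def horner_eq_poly \<phi>0)
    \<comment> \<open>The pseudo-remainder of \<open>h\<close> by \<open>g\<close> lies in
      \<open>P\<close> and has small degree, so it is in \<open>pX\<close>, where
      \<open>\<psi>\<close> vanishes. The factor \<open>\<phi> a ^ k\<close> can be
      cancelled.\<close>
    have P0: "\<psi> h = 0" if "h \<in> P" for h
    proof -
      obtain k w r where k: "smult (a ^ k) h = g * w + r" "degree r < degree g"
        using pseudo_division[OF dg, of h] unfolding a_def by blast
      have r: "r = [:a ^ k:] * h - g * w" using k(1) by simp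
      have "r \<in> P" unfolding r by (rule Pd(7)[OF Pd(3)[OF that] Pd(4)[OF gP]])
      then have "\<psi> r = 0" using X0 small_P k(2) by blast
      then have "\<psi> ([:a ^ k:] * h) = 0"
        using k(1) g0 \<psi>d(3,4) by (metis add_0_right mult_zero_left smult_P)
      then show ?thesis using ac by (simp only: \<psi>d(4) const ring_mapD(5)[OF \<phi>(1)]) simp
    qed
    have "\<psi> e = \<psi> u * \<psi> b"
      using P0[OF u] by (simp add: \<psi>d)
    then have "\<psi> b \<noteq> 0" using ac c const by auto
    then show ?thesis using \<psi> P0 const \<phi>(2) by auto
  qed
qed

section \<open>Central elements act by scalars\<close>

text \<open>\<open>'a\<close> modulo the right ideal \<open>J\<close> plays the role of a cyclic module over \<open>'a\<close> modulo \<open>I\<close>.\<close>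

locale cyclic_module = ideal_cong I for I :: "'a::ring_1 set" +
  fixes J :: "'a set"
  assumes I_sub_J: "I \<subseteq> J"
    and J_add: "a \<in> J \<Longrightarrow> b \<in> J \<Longrightarrow> a + b \<in> J"
    and J_rmult: "a \<in> J \<Longrightarrow> a * c \<in> J"
begin

definition eqJ :: "'a \<Rightarrow> 'a \<Rightarrow> bool" (infix \<open>\<sim>\<close> 50)
  where "a \<sim> b \<longleftrightarrow> a - b \<in> J"

lemma zero_J: "0 \<in> J"
  using zero_mem I_sub_J by auto

lemma J_uminus: "a \<in> J \<Longrightarrow> - a \<in> J"
  using J_rmult[of a "-1"] by simp

lemma eqJ_refl [simp]: "a \<sim> a"
  by (simp add: eqJ_def zero_J)

lemma eqJ_sym: "a \<sim> b \<Longrightarrow> b \<sim> a"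
  using J_uminus[of "a - b"] by (simp add: eqJ_def)

lemma eqJ_trans [trans]: "a \<sim> b \<Longrightarrow> b \<sim> c \<Longrightarrow> a \<sim> c"
  using J_add[of "a - b" "b - c"] by (simp add: eqJ_def)

lemma eqm_eqJ: "a \<approx> b \<Longrightarrow> a \<sim> b"
  using I_sub_J by (auto simp: eqJ_def eqm_def)

lemma eqJ_eqm_trans [trans]: "a \<sim> b \<Longrightarrow> b \<approx> c \<Longrightarrow> a \<sim> c"
  and eqm_eqJ_trans [trans]: "a \<approx> b \<Longrightarrow> b \<sim> c \<Longrightarrow> a \<sim> c"
  using eqm_eqJ eqJ_trans by blast+

lemma eqJ_add: "a \<sim> b \<Longrightarrow> c \<sim> d \<Longrightarrow> a + c \<sim> b + d"
  using J_add[of "a - b" "c - d"] by (simp add: eqJ_def algebra_simps)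

lemma eqJ_diff: "a \<sim> b \<Longrightarrow> c \<sim> d \<Longrightarrow> a - c \<sim> b - d"
  using J_add[OF _ J_uminus, of "a - b" "c - d"] by (simp add: eqJ_def algebra_simps)

lemma eqJ_rmult: "a \<sim> b \<Longrightarrow> a * c \<sim> b * c"
  using J_rmult[of "a - b" c] by (simp add: eqJ_def left_diff_distrib)

lemma eqJ_0_iff: "a \<sim> 0 \<longleftrightarrow> a \<in> J"
  by (simp add: eqJ_def)

lemma eqJ_mem: "a \<sim> b \<Longrightarrow> a \<in> J \<longleftrightarrow> b \<in> J"
  using eqJ_trans eqJ_sym by (metis eqJ_0_iff)

lemma eqm_mem: "a \<approx> b \<Longrightarrow> a \<in> J \<longleftrightarrow> b \<in> J"
  using eqJ_mem eqm_eqJ by blast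

lemma eqJ_sum: "(\<And>i. i \<in> A \<Longrightarrow> f i \<sim> g i) \<Longrightarrow> sum f A \<sim> sum g A"
  by (induction A rule: infinite_finite_induct) (auto intro: eqJ_add)

definition spanned :: "('s::comm_ring_1 \<Rightarrow> 'a) \<Rightarrow> ('l \<Rightarrow> 'a) \<Rightarrow> 'l set \<Rightarrow> 'a set"
  where "spanned f g A = {r. \<exists>s. r \<sim> (\<Sum>l\<in>A. g l * f (s l))}"

lemma spanned_cong: "r \<in> spanned f g A \<Longrightarrow> r' \<sim> r \<Longrightarrow> r' \<in> spanned f g A"
  unfolding spanned_def using eqJ_trans by blast

lemma spanned_insert:
  assumes "finite A" "k \<notin> A"
  shows "r \<in> spanned f g (insert k A) \<longleftrightarrow> (\<exists>s. r - g k * f s \<in> spanned f g A)"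
proof
  assume "r \<in> spanned f g (insert k A)"
  then obtain s where "r \<sim> g k * f (s k) + (\<Sum>l\<in>A. g l * f (s l))"
    using assms by (auto simp: spanned_def)
  then have "r - g k * f (s k) \<sim> (\<Sum>l\<in>A. g l * f (s l))"
    by (simp add: eqJ_def algebra_simps)
  then show "\<exists>s. r - g k * f s \<in> spanned f g A"
    by (auto simp: spanned_def)
next
  assume "\<exists>s. r - g k * f s \<in> spanned f g A"
  then obtain t s where "r - g k * f t \<sim> (\<Sum>l\<in>A. g l * f (s l))"
    by (auto simp: spanned_def)
  moreover have "(\<Sum>l\<in>A. g l * f ((s(k := t)) l)) = (\<Sum>l\<in>A. g l * f (s l))"
    using assms by (intro sum.cong) auto
  ultimately have "r \<sim> (\<Sum>l\<in>insert k A. g l * f ((s(k := t)) l))"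
    using assms by (simp add: eqJ_def algebra_simps)
  then show "r \<in> spanned f g (insert k A)"
    unfolding spanned_def by blast
qed

end

locale central_hom = cyclic_module I J for I J :: "'a::ring_1 set" +
  fixes f :: "'s::comm_ring_1 \<Rightarrow> 'a"
  assumes hom: "hom_mod f" and central: "comm (f s) a"
begin

lemma f_swap: "f s * a \<approx> a * f s"
  using central by (simp add: comm_def)

lemma spanned_0: "0 \<in> spanned f g A"
  unfolding spanned_def by (auto intro!: exI[of _ "\<lambda>_. 0"] simp: hom_modD(1)[OF hom])

lemma spanned_add:
  assumes "x \<in> spanned f g A" "y \<in> spanned f g A"
  shows "x + y \<in> spanned f g A"
proof -
  obtain s t where st: "x \<sim> (\<Sum>l\<in>A. g l * f (s l))" "y \<sim> (\<Sum>l\<in>A. g l * f (t l))"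
    using assms by (auto simp: spanned_def)
  have "x + y \<sim> (\<Sum>l\<in>A. g l * (f (s l) + f (t l)))"
    using eqJ_add[OF st] by (simp add: distrib_left sum.distrib)
  also have "\<dots> \<approx> (\<Sum>l\<in>A. g l * f (s l + t l))"
    by (intro eqm_sum eqm_lmult eqm_sym[OF hom_modD(3)[OF hom]])
  finally show ?thesis unfolding spanned_def by (auto intro: exI[of _ "\<lambda>l. s l + t l"])
qed

lemma spanned_scale:
  assumes "x \<in> spanned f g A"
  shows "x * f t \<in> spanned f g A"
proof -
  obtain s where s: "x \<sim> (\<Sum>l\<in>A. g l * f (s l))"
    using assms by (auto simp: spanned_def)
  have "x * f t \<sim> (\<Sum>l\<in>A. g l * (f (s l) * f t))"
    using eqJ_rmult[OF s, of "f t"] by (simp add: sum_distrib_right mult.assoc)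
  also have "\<dots> \<approx> (\<Sum>l\<in>A. g l * f (s l * t))"
    by (intro eqm_sum eqm_lmult eqm_sym[OF hom_modD(4)[OF hom]])
  finally show ?thesis unfolding spanned_def by (auto intro: exI[of _ "\<lambda>l. s l * t"])
qed

lemma spanned_base:
  assumes "finite A" "l \<in> A"
  shows "g l \<in> spanned f g A"
proof -
  have "(\<Sum>k\<in>A. g k * f (if k = l then 1 else 0)) = (\<Sum>k\<in>A. if k = l then g l * f 1 else 0)"
    by (intro sum.cong) (auto simp: hom_modD(1)[OF hom])
  also have "\<dots> = g l * f 1" using assms by simp
  also have "\<dots> \<approx> g l" using eqm_lmult[OF hom_modD(2)[OF hom], of "g l"] by simp
  finally have "g l \<sim> (\<Sum>k\<in>A. g k * f (if k = l then 1 else 0))"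
    using eqm_sym eqm_eqJ by blast
  then show ?thesis
    unfolding spanned_def by (auto intro: exI[of _ "\<lambda>k. if k = l then 1 else 0"])
qed

lemma spanned_sum:
  "(\<And>i. i \<in> B \<Longrightarrow> h i \<in> spanned f g A) \<Longrightarrow> sum h B \<in> spanned f g A"
  by (induction B rule: infinite_finite_induct) (auto intro: spanned_add spanned_0)

lemma spanned_mult:
  assumes "\<And>l. l \<in> A \<Longrightarrow> g l * r \<in> spanned f g A" "x \<in> spanned f g A"
  shows "x * r \<in> spanned f g A"
proof -
  obtain s where s: "x \<sim> (\<Sum>l\<in>A. g l * f (s l))"
    using assms by (auto simp: spanned_def)
  have "x * r \<sim> (\<Sum>l\<in>A. g l * (f (s l) * r))"
    using eqJ_rmult[OF s, of r] by (simp add: sum_distrib_right mult.assoc)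
  also have "\<dots> \<approx> (\<Sum>l\<in>A. g l * (r * f (s l)))"
    by (intro eqm_sum eqm_lmult f_swap)
  also have "\<dots> = (\<Sum>l\<in>A. (g l * r) * f (s l))"
    by (simp add: mult.assoc)
  finally show ?thesis
    by (rule spanned_cong[rotated]) (intro spanned_sum spanned_scale assms(1))
qed

end

locale simple_cyclic_module = cyclic_module I J for I J :: "'a::ring_1 set" +
  assumes one_notin_J: "1 \<notin> J"
    and J_maximal: "a \<notin> J \<Longrightarrow> \<exists>r. a * r \<sim> 1"
begin

text \<open>If \<open>f a\<close> does not kill the generator, simplicity recovers the generator as
  \<open>f a * r\<close>. Applying \<open>f b\<close> and using centrality gives
  \<open>f b \<sim> f (a * b) * r\<close>, so \<open>f b\<close> is zero as soon as
  \<open>f (a * b)\<close> is.\<close>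

lemma prime_annihilator:
  assumes f: "hom_mod f" and c: "\<And>s a. comm (f s) a"
  shows "prime_set {s. f s \<in> J}"
  unfolding prime_set_def mem_Collect_eq
proof (intro conjI ballI allI impI)
  note fd = hom_modD[OF f]
  show "f 0 \<in> J" "f 1 \<notin> J"
    using fd(1) zero_J one_notin_J eqm_mem[OF fd(2)] by auto
  fix a b
  show "f a \<in> J \<or> f b \<in> J" if ab: "f (a * b) \<in> J"
  proof (cases "f a \<in> J")
    case False
    then obtain r where r: "f a * r \<sim> 1" using J_maximal by blast
    have "f b = 1 * f b" by simp
    also have "\<dots> \<sim> (f a * r) * f b" by (rule eqJ_rmult[OF eqJ_sym[OF r]])
    also have "\<dots> = f a * (r * f b)" by (simp add: mult.assoc)
    also have "\<dots> \<approx> f a * (f b * r)"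
      by (rule eqm_lmult) (rule eqm_sym[OF c[unfolded comm_def]])
    also have "\<dots> = (f a * f b) * r" by (simp add: mult.assoc)
    also have "\<dots> \<approx> f (a * b) * r" by (rule eqm_rmult[OF eqm_sym[OF fd(4)]])
    also have "\<dots> \<sim> 0" using J_rmult[OF ab] by (simp add: eqJ_0_iff)
    finally show ?thesis by (simp add: eqJ_0_iff)
  qed simp
next
  fix a b assume b: "b \<in> {s. f s \<in> J}"
  have "f (a * b) \<sim> f b * f a"
    using hom_modD(4)[OF f, of b a] by (simp add: mult.commute eqm_eqJ)
  then show "f (a * b) \<in> J" using b J_rmult eqJ_mem by auto
  assume a: "a \<in> {s. f s \<in> J}"
  show "f (a + b) \<in> J" using eqm_mem[OF hom_modD(3)[OF f]] a b J_add by auto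
qed

text \<open>If the maximal ideal \<open>kernel \<phi>\<close> did not annihilate the module, one of its elements would act
  surjectively, against Nakayama's lemma.\<close>

lemma kernel_annihilates:
  assumes f: "hom_mod f" and c: "\<And>s a. comm (f s) a"
    and fg: "finite A" "spanned f g A = UNIV"
    and \<phi>: "ring_map \<phi>" "\<And>s. f s \<in> J \<Longrightarrow> \<phi> s = 0"
    and s0: "\<phi> s0 = 0"
  shows "f s0 \<in> J"
proof (rule ccontr)
  assume "f s0 \<notin> J"
  then obtain r0 where r0: "f s0 * r0 \<sim> 1" using J_maximal by blast
  interpret central_hom I J f using f c by unfold_locales
  note fd = hom_modD[OF f]
  have surj: "\<exists>r'. r \<sim> r' * f s0" for r
  proof -
    have "r = 1 * r" by simp
    also have "\<dots> \<sim> (f s0 * r0) * r" by (rule eqJ_rmult[OF eqJ_sym[OF r0]])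
    also have "\<dots> = f s0 * (r0 * r)" by (simp add: mult.assoc)
    also have "\<dots> \<approx> (r0 * r) * f s0" by (rule f_swap)
    finally show ?thesis by blast
  qed
  \<comment> \<open>Generators are discarded one at a time. Instead of localising at the kernel of
    \<open>\<phi>\<close>, the induction carries a multiplier \<open>e\<close> with
    \<open>\<phi> e = 1\<close> that sends the module into the span of the remaining generators.
    When none remain, \<open>f e\<close> kills the generator, so \<open>\<phi> e\<close> would be
    0.\<close>
  have False if "finite A" "\<phi> e = 1" "\<And>r. r * f e \<in> spanned f g A" for A e
    using that
  proof (induction A arbitrary: e)
    case empty
    from empty.prems(2)[of 1] have "f e \<in> J" by (simp add: spanned_def eqJ_0_iff)
    then show ?case using empty.prems(1) \<phi>(2) by simp
  next
    case (insert k A)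
    obtain r' where r': "g k \<sim> r' * f s0" using surj by blast
    obtain t where t: "r' * f e - g k * f t \<in> spanned f g A"
      using insert.prems(2) spanned_insert[OF insert.hyps] by blast
    \<comment> \<open>Since \<open>g k\<close> is \<open>r' * f s0\<close> and
      \<open>r' * f e\<close> equals \<open>g k * f t\<close> up to the span of \<open>A\<close>,
      the vectors \<open>g k * f e\<close> and \<open>g k * f (t * s0)\<close> agree up to that
      span. The difference \<open>e - t * s0\<close> still has value 1 under
      \<open>\<phi>\<close>.\<close>
    have gk: "g k * f (e - t * s0) \<in> spanned f g A"
    proof -
      have "g k * f (e - t * s0) \<approx> g k * (f e - f t * f s0)"
        by (rule eqm_lmult, rule eqm_trans[OF hom_mod_diff[OF f]]) (intro eqm_diff eqm_refl fd(4))
      also have "\<dots> = g k * f e - g k * f t * f s0" by (simp add: algebra_simps)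
      also have "\<dots> \<sim> r' * f s0 * f e - g k * f t * f s0"
        by (intro eqJ_diff eqJ_rmult r' eqJ_refl)
      also have "\<dots> = r' * (f s0 * f e) - g k * f t * f s0" by (simp add: algebra_simps)
      also have "\<dots> \<approx> r' * (f e * f s0) - g k * f t * f s0"
        by (intro eqm_diff eqm_lmult f_swap eqm_refl)
      also have "\<dots> = (r' * f e - g k * f t) * f s0" by (simp add: algebra_simps)
      finally show ?thesis by (rule spanned_cong[OF spanned_scale[OF t]])
    qed
    define e' where "e' = e - t * s0"
    have "\<phi> (e * e') = 1"
      using insert.prems(1) s0 by (simp add: e'_def ring_mapD[OF \<phi>(1)])
    moreover have "r * f (e * e') \<in> spanned f g A" for r
    proof -
      obtain u where u: "r * f e - g k * f u \<in> spanned f g A"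
        using insert.prems(2) spanned_insert[OF insert.hyps] by blast
      have "r * f (e * e') \<approx> r * (f e * f e')" by (intro eqm_lmult fd(4))
      also have "\<dots> = (r * f e - g k * f u) * f e' + g k * (f u * f e')"
        by (simp add: algebra_simps)
      also have "\<dots> \<approx> (r * f e - g k * f u) * f e' + g k * (f e' * f u)"
        by (intro eqm_add eqm_lmult f_swap eqm_refl)
      also have "\<dots> = (r * f e - g k * f u) * f e' + (g k * f e') * f u"
        by (simp add: algebra_simps)
      finally have "r * f (e * e') \<sim> (r * f e - g k * f u) * f e' + (g k * f e') * f u"
        by (rule eqm_eqJ)
      then show ?thesis
        by (rule spanned_cong[rotated]) (intro spanned_add spanned_scale u gk[folded e'_def])
    qed
    ultimately show ?case by (rule insert.IH)
  qed
  from this[OF fg(1), of 1] show False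
    using fg(2) ring_mapD(2)[OF \<phi>(1)] by simp
qed

text \<open>Separating 1 from the annihilator yields a point \<open>\<phi>\<close> of it. As
  \<open>s - \<iota> (\<phi> s)\<close> is in the kernel of \<open>\<phi>\<close>,
  \<open>kernel_annihilates\<close> turns the value of the point at \<open>s\<close> into the scalar
  by which \<open>f s\<close> acts.\<close>

lemma acts_by_scalars:
  assumes f: "hom_mod f" and c: "\<And>s a. comm (f s) a"
    and fg: "finite A" "spanned f g A = UNIV"
    and sep: "separates_primes \<iota>" and \<kappa>: "\<And>x. f (\<iota> x) \<approx> \<kappa> x"
  shows "\<exists>\<phi>. \<forall>s. f s \<sim> \<kappa> (\<phi> s)"
proof -
  define P where "P = {s. f s \<in> J}"
  have P: "prime_set P" unfolding P_def by (rule prime_annihilator[OF f c])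
  obtain \<phi> where \<phi>: "ring_map \<phi>" "\<And>x. \<phi> (\<iota> x) = x" "\<And>a. a \<in> P \<Longrightarrow> \<phi> a = 0"
    using sep P prime_setD(5)[OF P] unfolding separates_primes_def by blast
  have "f s \<sim> \<kappa> (\<phi> s)" for s
  proof -
    have "f (s - \<iota> (\<phi> s)) \<in> J"
      by (rule kernel_annihilates[OF f c fg \<phi>(1)]) (auto simp: \<phi> P_def ring_mapD[OF \<phi>(1)])
    then have "f s - f (\<iota> (\<phi> s)) \<in> J" using eqm_mem[OF hom_mod_diff[OF f]] by blast
    then have "f s \<sim> f (\<iota> (\<phi> s))" by (simp add: eqJ_def)
    then show ?thesis using \<kappa> eqJ_eqm_trans by blast
  qed
  then show ?thesis by blast
qed

end

section \<open>The reflection equation algebra\<close>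

lemma fconst_0 [simp]: "fconst 0 = 0"
  and fconst_1 [simp]: "fconst 1 = 1"
  and fconst_add: "fconst (a + b) = fconst a + fconst b"
  and fconst_diff: "fconst (a - b) = fconst a - fconst b"
  and fconst_uminus: "fconst (- a) = - fconst a"
  and fconst_mult: "fconst (a * b) = fconst a * fconst b"
  by (simp_all add: fconst_def single_add single_diff single_uminus mult_single)

lemma free_alg_induct [case_names const var add mult]:
  fixes r :: "('g, 'k::comm_ring_1) free_alg"
  assumes const: "\<And>c. P (fconst c)" and var: "\<And>g. P (fvar g)"
    and add: "\<And>a b. P a \<Longrightarrow> P b \<Longrightarrow> P (a + b)" and mult: "\<And>a b. P a \<Longrightarrow> P b \<Longrightarrow> P (a * b)"
  shows "P r"
proof -
  have word: "P (Poly_Mapping.single (Word w) c)" for w and c :: 'k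
  proof (induction w)
    case Nil
    then show ?case using const[of c] by (simp add: fconst_def zero_free_mon_def)
  next
    case (Cons g w)
    have "Poly_Mapping.single (Word (g # w)) c = fvar g * Poly_Mapping.single (Word w) c"
      by (simp add: fvar_def mult_single plus_free_mon_def)
    then show ?case using mult var Cons.IH by simp
  qed
  have zero: "P 0" using const[of 0] by simp
  have "P (\<Sum>m\<in>A. Poly_Mapping.single m (Poly_Mapping.lookup r m))" if "finite A" for A
    using that
  proof (induction A rule: finite_induct)
    case (insert m A)
    show ?case using insert word[of "letters m"] by (auto intro: add)
  qed (use zero in auto)
  moreover have "(\<Sum>m\<in>Poly_Mapping.keys r. Poly_Mapping.single m (Poly_Mapping.lookup r m)) = r"
    by (rule poly_mapping_eqI) (auto simp: lookup_sum lookup_single when_def in_keys_iff)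
  ultimately show ?thesis by (metis finite_keys)
qed

lemma fconst_central: "a * fconst c = fconst c * (a :: ('g, 'k::comm_ring_1) free_alg)"
proof (induction a rule: free_alg_induct)
  case (mult a b)
  have "a * b * fconst c = (a * fconst c) * b" using mult(2) by (simp add: mult.assoc)
  then show ?case using mult(1) by (simp add: mult.assoc)
qed (simp_all add: fconst_def fvar_def mult_single algebra_simps)

lemma fconst_left_comm:
  "a * (fconst c * b) = fconst c * (a * (b :: ('g, 'k::comm_ring_1) free_alg))"
  by (metis fconst_central mult.assoc)

lemma fconst_mult_left: "fconst a * (fconst b * z) = fconst (a * b) * (z :: ('g, 'k::comm_ring_1) free_alg)"
  by (simp add: fconst_mult mult.assoc)

lemma ideal_cong_rea_ideal: "ideal_cong (rea_ideal q)"
proof -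
  interpret ideal "rea_ideal q" free_alg_ring by (rule ideal_rea_ideal)
  show ?thesis
  proof
    show "0 \<in> rea_ideal q" using additive_subgroup.zero_closed[OF is_additive_subgroup] by (simp add: free_alg_ring_def)
    show "a + b \<in> rea_ideal q" if "a \<in> rea_ideal q" "b \<in> rea_ideal q" for a b
      using additive_subgroup.a_closed[OF is_additive_subgroup that] by (simp add: free_alg_ring_def)
  qed (use I_l_closed I_r_closed in \<open>auto simp: free_alg_ring_def\<close>)
qed

text \<open>The relations involve \<open>q\<close> only through \<open>q ^ 2\<close>. Recording the
  exact order \<open>n\<close> of \<open>q ^ 2\<close> treats odd and even \<open>m\<close>
  alike.\<close>

locale reflection_algebra =
  fixes q :: "'k::alg_closed_field" and n :: nat
  assumes q0: "q \<noteq> 0" and n0: "n > 0" and qn: "(q ^ 2) ^ n = 1"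
    and q_order: "0 < j \<Longrightarrow> j < n \<Longrightarrow> (q ^ 2) ^ j \<noteq> 1"
begin

abbreviation "e \<equiv> q ^ 2"
abbreviation "ei \<equiv> inverse (q ^ 2)"

lemma e0: "e \<noteq> 0" using q0 by simp

sublocale ideal_cong "rea_ideal q" by (rule ideal_cong_rea_ideal)

notation eqm (infix \<open>\<approx>\<close> 50)

abbreviation x :: "(gen, 'k) free_alg" where "x \<equiv> fvar U21"
abbreviation y :: "(gen, 'k) free_alg" where "y \<equiv> fvar U12"
abbreviation t :: "(gen, 'k) free_alg" where "t \<equiv> fvar U22"
abbreviation u :: "(gen, 'k) free_alg" where "u \<equiv> fvar U11"

text \<open>The quantum trace and the quantum determinant.\<close>

definition T :: "(gen, 'k) free_alg" where "T = u + fconst ei * t"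
definition D :: "(gen, 'k) free_alg" where "D = y * x - fconst ei * (u * t)"

lemma relators:
  "u * t - t * u \<in> rea_ideal q"
  "t * y - fconst e * y * t \<in> rea_ideal q"
  "x * t - fconst e * t * x \<in> rea_ideal q"
  "u * y - y * (u + fconst (ei - 1) * t) \<in> rea_ideal q"
  "x * u - (u + fconst (ei - 1) * t) * x \<in> rea_ideal q"
  "(x * y - y * x) - fconst (ei - 1) * t * (t - u) \<in> rea_ideal q"
proof -
  have "rea_relators q \<subseteq> rea_ideal q"
    unfolding rea_ideal_def
    by (rule ring.genideal_self[OF ring_free_alg_ring]) (simp add: free_alg_ring_def)
  then show "u * t - t * u \<in> rea_ideal q"
    "t * y - fconst e * y * t \<in> rea_ideal q"
    "x * t - fconst e * t * x \<in> rea_ideal q"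
    "u * y - y * (u + fconst (ei - 1) * t) \<in> rea_ideal q"
    "x * u - (u + fconst (ei - 1) * t) * x \<in> rea_ideal q"
    "(x * y - y * x) - fconst (ei - 1) * t * (t - u) \<in> rea_ideal q"
    by (auto simp: rea_relators_def Let_def)
qed

lemma e_ei: "fconst e * fconst ei = 1" "fconst ei * fconst e = 1"
  "fconst e * (fconst ei * z) = z" "fconst ei * (fconst e * z) = z"
  using e0 by (simp_all add: fconst_mult_left flip: fconst_mult)

lemmas rea_simps = fconst_central[of "fvar g" for g] fconst_left_comm[of "fvar g" for g]
  e_ei algebra_simps

text \<open>With the scalar split as \<open>fconst ei - 1\<close>, \<open>rea_simps\<close> can
  expand the combinations of relators below until their monomials cancel.\<close>

lemma relators':
  "u * t - t * u \<in> rea_ideal q"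
  "t * y - fconst e * y * t \<in> rea_ideal q"
  "x * t - fconst e * t * x \<in> rea_ideal q"
  "u * y - y * (u + (fconst ei - 1) * t) \<in> rea_ideal q"
  "x * u - (u + (fconst ei - 1) * t) * x \<in> rea_ideal q"
  "(x * y - y * x) - (fconst ei - 1) * t * (t - u) \<in> rea_ideal q"
  using relators by (simp_all add: fconst_diff)

text \<open>The coefficient of \<open>t\<close> in \<open>T\<close> is forced: the commutators of
  \<open>u\<close> with \<open>y\<close> and \<open>x\<close> are multiples of \<open>y * t\<close>
  and \<open>t * x\<close>, and those of \<open>ei\<close> times \<open>t\<close> are their
  negatives.\<close>

lemma comm_T: "comm T t" "comm T y" "comm T x"
proof -
  note r = relators'
  have "(u * y - y * (u + (fconst ei - 1) * t)) + fconst ei * (t * y - fconst e * y * t) \<in> rea_ideal q"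
    by (intro add_mem lmult_mem r)
  also have "(u * y - y * (u + (fconst ei - 1) * t)) + fconst ei * (t * y - fconst e * y * t)
      = T * y - y * T"
    by (simp add: T_def rea_simps)
  finally show "comm T y" by (simp add: comm_def eqm_def)
  have "(x * u - (u + (fconst ei - 1) * t) * x) + fconst ei * (x * t - fconst e * t * x) \<in> rea_ideal q"
    by (intro add_mem lmult_mem r)
  also have "(x * u - (u + (fconst ei - 1) * t) * x) + fconst ei * (x * t - fconst e * t * x)
      = x * T - T * x"
    by (simp add: T_def rea_simps)
  finally show "comm T x" using comm_sym by (simp add: comm_def eqm_def)
  show "comm T t" using r(1) by (simp add: comm_def eqm_def T_def rea_simps)
qed

text \<open>Each commutator is exhibited as an explicit combination of relators. The multipliers
  come from reordering words: \<open>?R6\<close> exchanges \<open>x\<close> and \<open>y\<close>,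
  \<open>?R5\<close> and \<open>?R3\<close> move \<open>x\<close> past \<open>u\<close> and
  \<open>t\<close>, \<open>?R4\<close> and \<open>?R2\<close> do so for \<open>y\<close>, and
  \<open>?R1\<close> corrects the order of \<open>u\<close> and \<open>t\<close>.\<close>

lemma comm_D: "comm D t" "comm D y" "comm D x"
proof -
  note r = relators'
  let ?R1 = "u * t - t * u" and ?R2 = "t * y - fconst e * y * t"
    and ?R3 = "x * t - fconst e * t * x" and ?R4 = "u * y - y * (u + (fconst ei - 1) * t)"
    and ?R5 = "x * u - (u + (fconst ei - 1) * t) * x"
    and ?R6 = "(x * y - y * x) - (fconst ei - 1) * t * (t - u)"
  have "?R6 * x - fconst ei * (?R5 * t) - (fconst ei * (u + (fconst ei - 1) * t)) * ?R3
      + (fconst ei - 1) * (?R1 * x) \<in> rea_ideal q"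
    by (intro add_mem lmult_mem rmult_mem diff_mem r)
  also have "?R6 * x - fconst ei * (?R5 * t) - (fconst ei * (u + (fconst ei - 1) * t)) * ?R3
      + (fconst ei - 1) * (?R1 * x) = x * D - D * x"
    by (simp add: D_def rea_simps)
  finally show "comm D x" using comm_sym by (simp add: comm_def eqm_def)
  have "(fconst ei * u) * ?R2 + ?R4 * t - y * ?R6 - ((fconst ei - 1) * y) * ?R1 \<in> rea_ideal q"
    by (intro add_mem lmult_mem rmult_mem diff_mem r)
  also have "(fconst ei * u) * ?R2 + ?R4 * t - y * ?R6 - ((fconst ei - 1) * y) * ?R1 = y * D - D * y"
    by (simp add: D_def rea_simps)
  finally show "comm D y" using comm_sym by (simp add: comm_def eqm_def)
  have "?R2 * x - y * ?R3 + fconst ei * (?R1 * t) \<in> rea_ideal q"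
    by (intro add_mem lmult_mem rmult_mem diff_mem r)
  also have "?R2 * x - y * ?R3 + fconst ei * (?R1 * t) = t * D - D * t"
    by (simp add: D_def rea_simps)
  finally show "comm D t" using comm_sym by (simp add: comm_def eqm_def)
qed

text \<open>The two products of \<open>x\<close> and \<open>y\<close> are the values of one quadratic polynomial in \<open>t\<close>, at
  arguments differing by the factor \<open>q\<^sup>2\<close>.\<close>

definition quad :: "'k \<Rightarrow> (gen, 'k) free_alg"
  where "quad c = D + fconst c * (T * t) - fconst (c ^ 2) * (t * t)"

text \<open>This is an identity already in the free algebra: the definition of \<open>D\<close>,
  with \<open>u\<close> eliminated through \<open>T\<close>. In contrast, \<open>x_y\<close> uses
  the relations.\<close>

lemma y_x: "y * x = quad ei"
  by (simp add: quad_def D_def T_def power2_eq_square[of ei] fconst_mult rea_simps)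

lemma x_y: "x * y \<approx> quad 1"
proof -
  have "((x * y - y * x) - (fconst ei - 1) * t * (t - u)) + (fconst ei - 1) * (u * t - t * u) \<in> rea_ideal q"
    by (intro add_mem lmult_mem relators')
  also have "((x * y - y * x) - (fconst ei - 1) * t * (t - u)) + (fconst ei - 1) * (u * t - t * u)
      = x * y - quad 1"
    by (simp add: quad_def D_def T_def rea_simps)
  finally show ?thesis by (simp add: eqm_def)
qed

lemma u_eq: "u = T - fconst ei * t"
  by (simp add: T_def)

definition central :: "(gen, 'k) free_alg \<Rightarrow> bool"
  where "central z \<longleftrightarrow> (\<forall>a. comm z a)"

lemma comm_fconst: "comm z (fconst c)" "comm (fconst c) z"
  by (simp_all add: comm_def fconst_central)

text \<open>Commutation with \<open>u\<close> follows from \<open>u_eq\<close> once \<open>T\<close>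
  is central, and \<open>T\<close> commutes with \<open>u\<close> because it commutes with itself
  and with \<open>t\<close>.\<close>

lemma centralI:
  assumes "comm z x" "comm z y" "comm z t"
  shows "central z"
proof -
  have T: "comm T a" if "a \<in> {x, y, t}" for a using that comm_T by auto
  have zu: "comm w u" if "comm w T" "comm w t" for w
    unfolding u_eq using that by (intro comm_diff comm_mult comm_fconst)
  have "comm T u" by (intro zu comm_T) simp
  have cT: "comm T a" for a
  proof (induction a rule: free_alg_induct)
    case (var g)
    then show ?case using T \<open>comm T u\<close> by (cases g) auto
  qed (auto intro: comm_add comm_mult comm_fconst)
  have "comm z u" using assms cT comm_sym zu by blast
  have "comm z a" for a
  proof (induction a rule: free_alg_induct)
    case (var g)
    then show ?case using assms \<open>comm z u\<close> by (cases g) auto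
  qed (auto intro: comm_add comm_mult comm_fconst)
  then show ?thesis by (simp add: central_def)
qed

lemma central_T: "central T" and central_D: "central D"
  by (auto intro!: centralI comm_T comm_D)

section \<open>Commutation with \<open>t\<close> and the central powers\<close>

definition skew :: "(gen, 'k) free_alg \<Rightarrow> 'k \<Rightarrow> bool"
  where "skew b c \<longleftrightarrow> b * t \<approx> fconst c * t * b"

lemma skew_power:
  assumes "skew b c"
  shows "skew (b ^ i) (c ^ i)"
proof (induction i)
  case (Suc i)
  have "b * (b ^ i * t) \<approx> b * (fconst (c ^ i) * t * b ^ i)"
    using Suc eqm_lmult by (simp add: skew_def)
  also have "\<dots> = fconst (c ^ i) * (b * t) * b ^ i"
    by (simp add: mult.assoc fconst_left_comm)
  also have "\<dots> \<approx> fconst (c ^ i) * (fconst c * t * b) * b ^ i"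
    using assms by (intro eqm_lmult eqm_rmult) (simp add: skew_def)
  also have "\<dots> = fconst (c ^ Suc i) * t * b ^ Suc i"
    by (simp add: mult.assoc fconst_mult_left mult.commute)
  finally show ?case by (simp add: skew_def mult.assoc)
qed (simp add: skew_def)

lemma skew_t_power:
  assumes "skew b c"
  shows "b * t ^ j \<approx> fconst (c ^ j) * (t ^ j * b)"
proof (induction j)
  case (Suc j)
  have "b * t * t ^ j \<approx> fconst c * t * b * t ^ j"
    using assms eqm_rmult by (simp add: skew_def)
  also have "\<dots> = fconst c * t * (b * t ^ j)" by (simp add: mult.assoc)
  also have "\<dots> \<approx> fconst c * t * (fconst (c ^ j) * (t ^ j * b))" by (rule eqm_lmult[OF Suc])
  also have "\<dots> = fconst (c ^ Suc j) * (t ^ Suc j * b)"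
    by (simp add: mult.assoc fconst_mult_left fconst_left_comm[of t])
  finally show ?case by (simp add: mult.assoc)
qed simp

text \<open>In \<open>quad d\<close> the parameter \<open>d\<close> accompanies each factor
  \<open>t\<close>, so an element that rescales \<open>t\<close> when moved past it rescales
  \<open>d\<close> and changes nothing else.\<close>

lemma skew_quad:
  assumes "skew b c"
  shows "b * quad d \<approx> quad (d * c) * b"
proof -
  have T: "b * T \<approx> T * b" and D: "b * D \<approx> D * b"
    using central_T central_D comm_sym unfolding central_def comm_def by (blast intro: eqm_sym)+
  have "b * (T * t) = b * T * t" by (simp add: mult.assoc)
  also have "\<dots> \<approx> T * b * t" by (rule eqm_rmult[OF T])
  also have "\<dots> = T * (b * t)" by (simp add: mult.assoc)
  also have "\<dots> \<approx> T * (fconst c * t * b)"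
    using assms by (intro eqm_lmult) (simp add: skew_def)
  also have "\<dots> = fconst c * (T * t) * b" by (simp add: mult.assoc fconst_left_comm)
  finally have Tt: "b * (T * t) \<approx> fconst c * (T * t) * b" .
  have tt: "b * (t * t) \<approx> fconst (c ^ 2) * ((t * t) * b)"
    using skew_t_power[OF assms, of 2] by (simp add: power2_eq_square)
  have "b * quad d = b * D + fconst d * (b * (T * t)) - fconst (d ^ 2) * (b * (t * t))"
    by (simp add: quad_def distrib_left right_diff_distrib fconst_left_comm[of b])
  also have "\<dots> \<approx> D * b + fconst d * (fconst c * (T * t) * b) - fconst (d ^ 2) * (fconst (c ^ 2) * ((t * t) * b))"
    by (intro eqm_add eqm_diff eqm_lmult D Tt tt)
  also have "\<dots> = quad (d * c) * b"
    by (simp add: quad_def distrib_right left_diff_distrib mult.assoc fconst_mult_left power_mult_distrib)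
  finally show ?thesis .
qed

lemma skew_x: "skew x e" and skew_y: "skew y ei"
proof -
  show "skew x e" using relators(3) by (simp add: skew_def eqm_def)
  have "t * y \<approx> fconst e * y * t" using relators(2) by (simp add: eqm_def)
  then have "fconst ei * (fconst e * y * t) \<approx> fconst ei * (t * y)"
    by (rule eqm_lmult[OF eqm_sym])
  then show "skew y ei" by (simp only: skew_def mult.assoc e_ei)
qed

lemma t_y: "t ^ j * y \<approx> fconst (e ^ j) * (y * t ^ j)"
proof -
  have "fconst (e ^ j) * (y * t ^ j) \<approx> fconst (e ^ j) * (fconst (ei ^ j) * (t ^ j * y))"
    by (rule eqm_lmult[OF skew_t_power[OF skew_y]])
  also have "\<dots> = t ^ j * y"
    using e0 by (simp add: fconst_mult_left flip: power_mult_distrib)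
  finally show ?thesis by (rule eqm_sym)
qed

lemma ein: "ei ^ n = 1"
  using qn by (simp add: power_inverse)

lemma x_pow_y: "x ^ Suc k * y \<approx> quad (e ^ k) * x ^ k"
proof -
  have "x ^ Suc k * y = x ^ k * (x * y)" by (simp only: power_Suc2 mult.assoc)
  also have "\<dots> \<approx> x ^ k * quad 1" by (rule eqm_lmult[OF x_y])
  also have "\<dots> \<approx> quad (e ^ k) * x ^ k" using skew_quad[OF skew_power[OF skew_x], of k 1] by simp
  finally show ?thesis .
qed

lemma y_pow_x: "y ^ Suc k * x \<approx> quad (ei ^ Suc k) * y ^ k"
proof -
  have "y ^ Suc k * x = y ^ k * quad ei" by (simp only: power_Suc2 mult.assoc flip: y_x)
  also have "\<dots> \<approx> quad (ei ^ Suc k) * y ^ k" using skew_quad[OF skew_power[OF skew_y], of k ei] by simp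
  finally show ?thesis .
qed

text \<open>Moving \<open>x\<close> past \<open>quad 1\<close> repeatedly multiplies its parameter
  by \<open>e\<close>. After \<open>n - 1\<close> steps it is \<open>ei\<close>, so
  \<open>x * y\<close> has become \<open>y * x\<close> and
  \<open>x ^ n * y \<approx> y * x ^ n\<close>. The same cycle runs backwards for
  \<open>y ^ n\<close>.\<close>

lemma central_powers: "central (x ^ n)" "central (y ^ n)" "central (t ^ n)"
proof -
  obtain k where k: "n = Suc k" using n0 by (cases n) auto
  have ek: "e ^ k = ei" using qn e0 by (simp add: k field_simps)
  have "comm (x ^ n) t"
    using skew_power[OF skew_x, of n] qn by (simp add: skew_def comm_def)
  moreover have "comm (x ^ n) y"
  proof -
    have "x ^ n * y \<approx> (y * x) * x ^ k" using x_pow_y[of k] by (simp add: k ek y_x)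
    then show ?thesis by (simp add: comm_def k mult.assoc)
  qed
  ultimately show "central (x ^ n)"
    by (intro centralI comm_sym[OF comm_power[of x x]]) auto
  have "comm (y ^ n) t"
    using skew_power[OF skew_y, of n] ein by (simp add: skew_def comm_def)
  moreover have "comm (y ^ n) x"
  proof -
    have "y ^ n * x \<approx> quad 1 * y ^ k" using y_pow_x[of k] ein by (simp add: k)
    also have "\<dots> \<approx> (x * y) * y ^ k" by (rule eqm_rmult[OF eqm_sym[OF x_y]])
    finally show ?thesis by (simp add: comm_def k mult.assoc)
  qed
  ultimately show "central (y ^ n)"
    by (intro centralI comm_sym[OF comm_power[of y y]]) auto
  have "comm x (t ^ n)" "comm y (t ^ n)"
    using skew_t_power[OF skew_x, of n] skew_t_power[OF skew_y, of n] qn ein by (simp_all add: comm_def)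
  then show "central (t ^ n)"
    by (intro centralI comm_sym[OF comm_power[of t t]] comm_sym[of x] comm_sym[of y]) auto
qed

end

section \<open>Finite generation over the central subring\<close>

lemma hom_mod_fconst: "ideal_cong I \<Longrightarrow> ideal_cong.hom_mod I (fconst :: 'k::comm_ring_1 \<Rightarrow> ('g, 'k) free_alg)"
  by (simp add: ideal_cong.hom_mod_def ideal_cong.eqm_refl fconst_add fconst_mult)

context reflection_algebra
begin

text \<open>This is the invariant for adjoining central elements one by one. Each step replaces the
  coefficient ring by its polynomial ring, so its type changes and the five steps are chained
  explicitly rather than by induction.\<close>

definition central_family :: "('k \<Rightarrow> 's::comm_ring_1) \<Rightarrow> ('s \<Rightarrow> (gen, 'k) free_alg) \<Rightarrow> bool"
  where "central_family \<iota> f \<longleftrightarrow> hom_mod f \<and> (\<forall>s. central (f s)) \<and> separates_primes \<iota> \<and>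
    (\<forall>c. f (\<iota> c) \<approx> fconst c)"

definition covers :: "('s \<Rightarrow> (gen, 'k) free_alg) \<Rightarrow> (gen, 'k) free_alg \<Rightarrow> bool"
  where "covers f z \<longleftrightarrow> (\<exists>s. f s \<approx> z)"

lemma central_family_fconst: "central_family (\<lambda>c. c) fconst"
  using hom_mod_fconst[OF ideal_cong_rea_ideal[of q]] separates_primes_field
  by (auto simp: central_family_def central_def comm_fconst)

lemma central_family_horner:
  assumes "central_family \<iota> f" "central z"
  shows "central_family (\<lambda>c. [:\<iota> c:]) (horner f z)" "covers (horner f z) z"
    "covers f w \<Longrightarrow> covers (horner f z) w"
proof -
  have f: "hom_mod f" and c: "comm a (f s)" "comm a z" "comm z a"
    and sep: "separates_primes \<iota>" and \<iota>: "f (\<iota> d) \<approx> fconst d" for a s d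
    using assms comm_sym by (auto simp: central_family_def central_def)
  note f0 = hom_modD(1)[OF f]
  have "central (horner f z p)" for p
    unfolding central_def by (intro allI comm_sym[OF comm_horner] f0 c)
  then show "central_family (\<lambda>c. [:\<iota> c:]) (horner f z)"
    unfolding central_family_def using hom_mod_horner[OF f c(1)] separates_primes_poly[OF sep] \<iota>
    by (simp add: horner_const f0)
  show "covers (horner f z) z"
    unfolding covers_def using horner_X[OF f] by blast
  show "covers (horner f z) w" if "covers f w"
    using that horner_const[of f z] f0 unfolding covers_def by metis
qed

text \<open>The words are ordered with \<open>y\<close> before \<open>t\<close> before
  \<open>x\<close>. The generator \<open>u\<close> is missing because \<open>u_eq\<close> expresses
  it by \<open>t\<close> and the coefficient \<open>T\<close>.\<close>

definition monomial :: "nat \<times> nat \<times> nat \<Rightarrow> (gen, 'k) free_alg"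
  where "monomial = (\<lambda>(i, j, k). y ^ i * (t ^ j * x ^ k))"

end

locale reflection_module = reflection_algebra q n + cyclic_module "rea_ideal q" J
  for q :: "'k::alg_closed_field" and n J
begin

notation eqJ (infix \<open>\<sim>\<close> 50)

lemma spanned_rmult:
  assumes f: "hom_mod f" "\<And>s. central (f s)" "\<And>c. covers f (fconst c)"
    and gen: "\<And>l h. l \<in> A \<Longrightarrow> g l * fvar h \<in> spanned f g A"
    and z: "z \<in> spanned f g A"
  shows "z * r \<in> spanned f g A"
proof -
  interpret central_hom "rea_ideal q" J f
    using f by unfold_locales (auto simp: central_def)
  have scale: "z * fconst c \<in> spanned f g A" if "z \<in> spanned f g A" for z c
  proof -
    obtain s where "f s \<approx> fconst c" using f(3)[of c] unfolding covers_def by blast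
    then have "z * fconst c \<sim> z * f s" by (rule eqm_eqJ[OF eqm_lmult[OF eqm_sym]])
    then show ?thesis using spanned_scale[OF that] spanned_cong by blast
  qed
  show ?thesis
    using z
  proof (induction r arbitrary: z rule: free_alg_induct)
    case (const c)
    then show ?case by (rule scale)
  next
    case (var h)
    then show ?case using spanned_mult[of A g "fvar h" z] gen by blast
  next
    case (add a b)
    show ?case
      using spanned_add[OF add.IH(1)[OF add.prems] add.IH(2)[OF add.prems]]
      by (simp add: distrib_left)
  next
    case (mult a b)
    show ?case using mult.IH(2)[OF mult.IH(1)[OF mult.prems]] by (simp add: mult.assoc)
  qed
qed

lemma spanned_UNIV:
  assumes f: "hom_mod f" "\<And>s. central (f s)" "\<And>c. covers f (fconst c)"
    and one: "1 \<in> spanned f g A"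
    and gen: "\<And>l h. l \<in> A \<Longrightarrow> g l * fvar h \<in> spanned f g A"
  shows "spanned f g A = UNIV"
  using spanned_rmult[OF f gen one] by auto

text \<open>Central powers absorb large exponents, so it suffices that ordered words of arbitrary
  exponents are closed under right multiplication by generators. Appending \<open>x\<close> is
  immediate, \<open>t\<close> moves left past the powers of \<open>x\<close> up to a scalar, and
  \<open>u\<close> reduces to \<open>T\<close> and \<open>t\<close>; the case of \<open>y\<close>
  uses \<open>x_pow_y\<close>.\<close>

lemma finitely_generated_over_centre:
  assumes fam: "central_family \<iota> f"
    and cov: "covers f T" "covers f D" "covers f (x ^ n)" "covers f (y ^ n)" "covers f (t ^ n)"
  shows "spanned f monomial ({..<n} \<times> {..<n} \<times> {..<n}) = UNIV" (is "?S = UNIV")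
proof -
  have f: "hom_mod f" "\<And>s. central (f s)" and covc: "\<And>c. covers f (fconst c)"
    using fam by (auto simp: central_family_def covers_def)
  interpret central_hom "rea_ideal q" J f
    using f by unfold_locales (auto simp: central_def)
  have insert_central: "a * (z * b) \<in> ?S" if z: "covers f z" and ab: "a * b \<in> ?S" for a z b
  proof -
    obtain s where s: "f s \<approx> z" using z unfolding covers_def by blast
    have "a * (z * b) \<approx> a * (f s * b)" by (intro eqm_lmult eqm_rmult) (rule eqm_sym[OF s])
    also have "\<dots> \<approx> a * (b * f s)" by (intro eqm_lmult f_swap)
    also have "\<dots> = (a * b) * f s" by (simp add: mult.assoc)
    finally show ?thesis using spanned_cong[OF spanned_scale[OF ab]] eqm_eqJ by blast
  qed
  have covers_power: "covers f (z ^ k)" if z: "covers f z" for z k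
  proof -
    obtain s where "f s \<approx> z" using z unfolding covers_def by blast
    then have "f (s ^ k) \<approx> z ^ k" using eqm_trans[OF hom_mod_power[OF f(1)] eqm_power] by blast
    then show ?thesis unfolding covers_def by blast
  qed
  \<comment> \<open>The exponent is divided by \<open>n\<close>: the power of \<open>z ^ n\<close>
    is a central coefficient, and only \<open>i mod n\<close> stays in the word.\<close>
  have reduce: "a * (z ^ i * b) \<in> ?S" if "covers f (z ^ n)" "a * (z ^ (i mod n) * b) \<in> ?S" for a z b i
  proof -
    have "z ^ i = (z ^ n) ^ (i div n) * z ^ (i mod n)"
      by (simp flip: power_mult power_add)
    then show ?thesis
      using insert_central[OF covers_power[OF that(1), of "i div n"] that(2)] by (simp add: mult.assoc)
  qed
  have mon: "y ^ i * (t ^ j * x ^ k) \<in> ?S" for i j k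
  proof -
    have "monomial (i mod n, j mod n, k mod n) \<in> ?S"
      using n0 by (intro spanned_base) auto
    then have "1 * (y ^ (i mod n) * (t ^ (j mod n) * x ^ (k mod n))) \<in> ?S" by (simp add: monomial_def)
    then have "1 * (y ^ i * (t ^ (j mod n) * x ^ (k mod n))) \<in> ?S" by (rule reduce[OF cov(4)])
    then have "y ^ i * (t ^ (j mod n) * x ^ (k mod n)) \<in> ?S" by simp
    then have "y ^ i * (t ^ j * x ^ (k mod n)) \<in> ?S" by (rule reduce[OF cov(5)])
    then have "(y ^ i * t ^ j) * (x ^ (k mod n) * 1) \<in> ?S" by (simp add: mult.assoc)
    then have "(y ^ i * t ^ j) * (x ^ k * 1) \<in> ?S" by (rule reduce[OF cov(3)])
    then show ?thesis by (simp add: mult.assoc)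
  qed
  have scale: "fconst c * a \<in> ?S" if "a \<in> ?S" for c a
    using insert_central[OF covc, of 1 a] that by simp
  have diff: "a - b \<in> ?S" if "a \<in> ?S" "b \<in> ?S" for a b
    using spanned_add[OF that(1) scale[OF that(2), of "-1"]] by (simp add: fconst_uminus)
  have cong: "a \<in> ?S" if "b \<in> ?S" "a \<approx> b" for a b
    using spanned_cong that eqm_eqJ by blast
  have monx: "y ^ i * (t ^ j * x ^ k) * x \<in> ?S" for i j k
    using mon[of i j "Suc k"] by (simp add: mult.assoc power_commutes)
  have mont: "y ^ i * (t ^ j * x ^ k) * t \<in> ?S" for i j k
  proof -
    have "y ^ i * (t ^ j * x ^ k) * t = y ^ i * t ^ j * (x ^ k * t)" by (simp add: mult.assoc)
    also have "\<dots> \<approx> y ^ i * t ^ j * (fconst (e ^ k) * t * x ^ k)"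
      using skew_power[OF skew_x, of k] by (intro eqm_lmult) (simp add: skew_def)
    also have "\<dots> = fconst (e ^ k) * (y ^ i * (t ^ Suc j * x ^ k))"
      by (simp add: mult.assoc fconst_left_comm power_Suc2 del: power_Suc)
    finally show ?thesis by (rule cong[rotated]) (intro scale mon)
  qed
  have mony: "y ^ i * (t ^ j * x ^ k) * y \<in> ?S" for i j k
  proof (cases k)
    case 0
    have "y ^ i * (t ^ j * x ^ k) * y = y ^ i * (t ^ j * y)" by (simp add: 0 mult.assoc)
    also have "\<dots> \<approx> y ^ i * (fconst (e ^ j) * (y * t ^ j))" by (intro eqm_lmult t_y)
    also have "\<dots> = fconst (e ^ j) * (y ^ Suc i * (t ^ j * x ^ 0))"
      by (simp add: mult.assoc fconst_left_comm power_Suc2 del: power_Suc)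
    finally show ?thesis by (rule cong[rotated]) (intro scale mon)
  next
    case (Suc l)
    let ?a = "y ^ i * t ^ j"
    have "y ^ i * (t ^ j * x ^ k) * y = ?a * (x ^ Suc l * y)" by (simp add: Suc mult.assoc)
    \<comment> \<open>The new \<open>y\<close> is consumed together with one \<open>x\<close>, which
      leaves only \<open>T\<close>, \<open>D\<close> and \<open>t\<close> to be put in
      order.\<close>
    also have "\<dots> \<approx> ?a * (quad (e ^ l) * x ^ l)" by (intro eqm_lmult x_pow_y)
    also have "\<dots> = ?a * (D * x ^ l) + fconst (e ^ l) * (?a * (T * (t * x ^ l)))
        - fconst ((e ^ l) ^ 2) * (?a * (t * (t * x ^ l)))"
      by (simp add: quad_def distrib_left distrib_right left_diff_distrib right_diff_distrib mult.assoc
          fconst_left_comm[where b = "_ * _"])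
    finally have eq: "y ^ i * (t ^ j * x ^ k) * y \<approx> ?a * (D * x ^ l) + fconst (e ^ l) * (?a * (T * (t * x ^ l)))
        - fconst ((e ^ l) ^ 2) * (?a * (t * (t * x ^ l)))" .
    have "?a * x ^ l \<in> ?S" "?a * (t * x ^ l) \<in> ?S" "?a * (t * (t * x ^ l)) \<in> ?S"
      using mon[of i j l] mon[of i "Suc j" l] mon[of i "Suc (Suc j)" l]
      by (simp_all add: mult.assoc power_Suc2 del: power_Suc)
    then show ?thesis
      by (intro cong[OF _ eq] diff spanned_add scale insert_central[OF cov(1)] insert_central[OF cov(2)])
  qed
  have monu: "y ^ i * (t ^ j * x ^ k) * u \<in> ?S" for i j k
  proof -
    let ?m = "y ^ i * (t ^ j * x ^ k)"
    have "?m * u = ?m * (T * 1) - fconst ei * (?m * t)"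
      by (simp add: u_eq right_diff_distrib fconst_left_comm)
    also have "\<dots> \<in> ?S"
      using mon by (intro diff scale mont insert_central cov) simp
    finally show ?thesis .
  qed
  show ?thesis
  proof (rule spanned_UNIV[OF f covc])
    show "1 \<in> ?S" using mon[of 0 0 0] by simp
    fix l h
    assume "l \<in> {..<n} \<times> {..<n} \<times> {..<n}"
    obtain i j k where "l = (i, j, k)" by (cases l) auto
    then have "monomial l = y ^ i * (t ^ j * x ^ k)" by (simp add: monomial_def)
    then show "monomial l * fvar h \<in> ?S"
      using monx mony mont monu by (cases h) simp_all
  qed
qed

end

section \<open>Scalars and eigenvectors in a simple module\<close>

locale simple_reflection_module = reflection_module q n J +
    simple_cyclic_module "rea_ideal q" J for q :: "'k::alg_closed_field" and n J +
  assumes torsionfree: "a * t \<in> J \<Longrightarrow> a \<in> J"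
begin

lemma central_scalars:
  "\<exists>c. T \<sim> fconst c" "\<exists>c. D \<sim> fconst c" "\<exists>c. x ^ n \<sim> fconst c" "\<exists>c. y ^ n \<sim> fconst c"
  "\<exists>c. t ^ n \<sim> fconst c"
proof -
  note h = central_family_horner
  note f1 = h[OF central_family_fconst central_T]
  note f2 = h[OF f1(1) central_D]
  note f3 = h[OF f2(1) central_powers(1)]
  note f4 = h[OF f3(1) central_powers(2)]
  note f5 = h[OF f4(1) central_powers(3)]
  \<comment> \<open>Five nested evaluations: the source is the polynomial ring in five variables,
    seen as an iterated univariate one, and the variables go to \<open>T\<close>, \<open>D\<close>,
    \<open>x ^ n\<close>, \<open>y ^ n\<close> and \<open>t ^ n\<close>.\<close>
  define f where "f = horner (horner (horner (horner (horner fconst T) D) (x ^ n)) (y ^ n)) (t ^ n)"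
  note fam = f5(1)[folded f_def]
  have cov: "covers f T" "covers f D" "covers f (x ^ n)" "covers f (y ^ n)" "covers f (t ^ n)"
    unfolding f_def by (intro f5(2) f5(3) f4(2) f4(3) f3(2) f3(3) f2(2) f2(3) f1(2))+
  have hc: "hom_mod f" "\<And>s a. comm (f s) a" and sep: "separates_primes (\<lambda>c::'k. [:[:[:[:[:c:]:]:]:]:])"
    and fc: "\<And>c. f [:[:[:[:[:c:]:]:]:]:] \<approx> fconst c"
    using fam by (auto simp: central_family_def central_def)
  obtain \<phi> where \<phi>: "\<And>s. f s \<sim> fconst (\<phi> s)"
    using acts_by_scalars[OF hc _ finitely_generated_over_centre[OF fam cov] sep fc] by auto
  have "\<exists>c. z \<sim> fconst c" if "covers f z" for z
    using that \<phi> eqm_sym eqm_eqJ_trans unfolding covers_def by meson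
  then show "\<exists>c. T \<sim> fconst c" "\<exists>c. D \<sim> fconst c" "\<exists>c. x ^ n \<sim> fconst c" "\<exists>c. y ^ n \<sim> fconst c"
    "\<exists>c. t ^ n \<sim> fconst c"
    using cov by blast+
qed

lemma fconst_mem: "fconst c \<in> J \<longleftrightarrow> c = 0"
proof
  assume "fconst c \<in> J"
  then have "fconst c * fconst (inverse c) \<in> J" by (rule J_rmult)
  then show "c = 0" using one_notin_J by (cases "c = 0") (auto simp flip: fconst_mult)
qed (simp add: zero_J)

lemma scale_mem: "fconst c * a \<in> J \<longleftrightarrow> c = 0 \<or> a \<in> J"
proof
  assume "fconst c * a \<in> J"
  then have "fconst c * a * fconst (inverse c) \<in> J" by (rule J_rmult)
  then show "c = 0 \<or> a \<in> J"
    by (cases "c = 0") (auto simp: mult.assoc fconst_central[of a] fconst_mult_left)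
next
  assume "c = 0 \<or> a \<in> J"
  then show "fconst c * a \<in> J" using J_rmult[of a "fconst c"] by (auto simp: zero_J fconst_central)
qed

lemma eqJ_scale: "a \<sim> b \<Longrightarrow> fconst c * a \<sim> fconst c * b"
  using scale_mem[of c "a - b"] by (simp add: eqJ_def right_diff_distrib)

text \<open>The generator has a minimal polynomial \<open>p\<close> with respect to
  \<open>t\<close>, because \<open>t ^ n\<close> is a scalar on it. Removing from \<open>p\<close>
  the linear factor of a root \<open>l\<close> leaves, by minimality, a nonzero vector of eigenvalue
  \<open>l\<close>.\<close>

lemma t_eigenvector: "\<exists>a l. a \<notin> J \<and> l \<noteq> 0 \<and> a * t \<sim> fconst l * a"
proof -
  obtain \<tau> where \<tau>: "t ^ n \<sim> fconst \<tau>" using central_scalars(5) by blast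
  define ev where "ev = horner (fconst :: 'k \<Rightarrow> (gen, 'k) free_alg) t"
  have h: "hom_mod (fconst :: 'k \<Rightarrow> (gen, 'k) free_alg)"
    by (rule hom_mod_fconst[OF ideal_cong_rea_ideal])
  have ev: "hom_mod ev" unfolding ev_def by (rule hom_mod_horner[OF h comm_fconst(1)])
  define p0 where "p0 = [:0, 1:] ^ n - [:\<tau>:]"
  have "degree ([:0, 1::'k:] ^ n) = n" by (rule degree_linear_power)
  then have p0: "p0 \<noteq> 0" using n0 by (auto simp: p0_def)
  have "ev p0 \<approx> ev ([:0, 1:] ^ n) - ev [:\<tau>:]"
    unfolding p0_def by (rule hom_mod_diff[OF ev])
  also have "\<dots> \<approx> t ^ n - fconst \<tau>"
    using eqm_trans[OF hom_mod_power[OF ev] eqm_power[OF horner_X[OF h, of t, folded ev_def]]]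
    by (intro eqm_diff) (auto simp: ev_def horner_const)
  also have "\<dots> \<sim> 0" using \<tau> by (simp add: eqJ_def)
  finally have "ev p0 \<in> J" by (simp add: eqJ_0_iff)
  then obtain p where p: "p \<noteq> 0" "ev p \<in> J"
    and pmin: "\<And>p'. p' \<noteq> 0 \<Longrightarrow> ev p' \<in> J \<Longrightarrow> degree p \<le> degree p'"
    using ex_has_least_nat[of "\<lambda>p. p \<noteq> 0 \<and> ev p \<in> J" p0 degree] p0 by blast
  have "degree p > 0"
  proof (rule ccontr)
    assume "\<not> degree p > 0"
    then obtain c where "p = [:c:]" using degree_eq_zeroE[of p] by auto
    then show False using p by (simp add: ev_def horner_const fconst_mem)
  qed
  then obtain l where "poly p l = 0" using alg_closed_imp_poly_has_root by blast
  then obtain p' where p': "p = p' * [:- l, 1:]" using poly_eq_0_iff_dvd by (metis dvdE mult.commute)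
  define a where "a = ev p'"
  have "ev p \<approx> ev p' * ev [:- l, 1:]" unfolding p' by (rule hom_modD(4)[OF ev])
  also have "\<dots> = a * t - fconst l * a"
    by (simp add: fconst_uminus a_def ev_def horner_pCons distrib_left right_diff_distrib fconst_central)
  finally have "a * t \<sim> fconst l * a" using p(2) eqm_mem by (simp add: eqJ_def)
  moreover have "a \<notin> J"
  proof
    assume "a \<in> J"
    moreover have "p' \<noteq> 0" using p(1) p' by auto
    moreover have "degree p = Suc (degree p')"
      using \<open>p' \<noteq> 0\<close> by (subst p', subst degree_mult_eq) auto
    ultimately show False using pmin[of p'] by (simp add: a_def)
  qed
  \<comment> \<open>Eigenvalue 0 would make \<open>a\<close> a nonzero vector killed by
    \<open>t\<close>.\<close>
  moreover have "l \<noteq> 0"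
    using calculation torsionfree by (auto simp: eqJ_0_iff)
  ultimately show ?thesis by blast
qed

end

section \<open>Bases of weight vectors\<close>

context simple_reflection_module
begin

text \<open>Applying \<open>t\<close> and subtracting \<open>\<mu> k\<close> times the relation
  removes the term at \<open>k\<close> and multiplies each other coefficient by a nonzero difference
  of eigenvalues.\<close>

lemma weights_independent:
  assumes "finite A" "\<And>i. i \<in> A \<Longrightarrow> b i \<notin> J" "\<And>i. i \<in> A \<Longrightarrow> b i * t \<sim> fconst (\<mu> i) * b i"
    and "inj_on \<mu> A" "(\<Sum>i\<in>A. fconst (c i) * b i) \<in> J" "i \<in> A"
  shows "c i = 0"
  using assms
proof (induction A arbitrary: c i rule: finite_induct)
  case (insert k A)
  let ?S = "\<Sum>i\<in>A. fconst (c i) * b i"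
  have S: "?S \<sim> - (fconst (c k) * b k)"
    using insert.prems(4) insert.hyps by (simp add: eqJ_def add.commute)
  have "?S * t = (\<Sum>i\<in>A. fconst (c i) * (b i * t))"
    by (simp add: sum_distrib_right mult.assoc)
  also have "\<dots> \<sim> (\<Sum>i\<in>A. fconst (c i) * (fconst (\<mu> i) * b i))"
    using insert.prems by (intro eqJ_sum eqJ_scale) auto
  finally have 1: "?S * t \<sim> (\<Sum>i\<in>A. fconst (c i) * (fconst (\<mu> i) * b i))" .
  have "?S * t \<sim> - (fconst (c k) * b k) * t" by (rule eqJ_rmult[OF S])
  also have "\<dots> = fconst (- c k) * (b k * t)" by (simp add: mult.assoc fconst_uminus)
  also have "\<dots> \<sim> fconst (- c k) * (fconst (\<mu> k) * b k)"
    using insert.prems by (intro eqJ_scale) auto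
  also have "\<dots> = fconst (\<mu> k) * - (fconst (c k) * b k)"
    by (simp add: fconst_mult_left fconst_uminus mult.commute)
  also have "\<dots> \<sim> fconst (\<mu> k) * ?S" by (intro eqJ_scale eqJ_sym[OF S])
  finally have "(\<Sum>i\<in>A. fconst (c i) * (fconst (\<mu> i) * b i)) \<sim> fconst (\<mu> k) * ?S"
    using 1 eqJ_trans eqJ_sym by blast
  moreover have "(\<Sum>i\<in>A. fconst (c i) * (fconst (\<mu> i) * b i)) - fconst (\<mu> k) * ?S
      = (\<Sum>i\<in>A. fconst (c i * (\<mu> i - \<mu> k)) * b i)"
    by (simp add: sum_distrib_left fconst_mult_left right_diff_distrib fconst_diff left_diff_distrib
        sum_subtractf mult.commute[of "\<mu> k"])
  ultimately have "(\<Sum>i\<in>A. fconst (c i * (\<mu> i - \<mu> k)) * b i) \<in> J" by (simp add: eqJ_def)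
  then have "c i * (\<mu> i - \<mu> k) = 0" if "i \<in> A" for i
    using insert.IH[of "\<lambda>i. c i * (\<mu> i - \<mu> k)" i] insert.prems that by (auto simp: inj_on_def)
  moreover have "\<mu> i \<noteq> \<mu> k" if "i \<in> A" for i
    using insert.prems(3) insert.hyps that by (auto simp: inj_on_def)
  ultimately have A: "c i = 0" if "i \<in> A" for i using that by fastforce
  then have "?S = 0" by simp
  then have "fconst (c k) * b k \<in> J" using insert.prems(4) insert.hyps by simp
  then have "c k = 0" using scale_mem insert.prems(1) by blast
  then show ?case using A insert.prems(5) by blast
qed auto

definition basis :: "nat \<Rightarrow> (nat \<Rightarrow> (gen, 'k) free_alg) \<Rightarrow> bool"
  where "basis d b \<longleftrightarrow>
    (\<forall>r. \<exists>!c. c \<in> {..<d} \<rightarrow>\<^sub>E UNIV \<and> r \<sim> (\<Sum>i\<in>{..<d}. b i * fconst (c i)))"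

lemma basisI:
  assumes "\<And>i. i < d \<Longrightarrow> b i \<notin> J" "\<And>i. i < d \<Longrightarrow> b i * t \<sim> fconst (\<mu> i) * b i"
    and "inj_on \<mu> {..<d}" and span: "spanned fconst b {..<d} = UNIV"
  shows "basis d b"
  unfolding basis_def
proof
  fix r
  obtain c where c: "r \<sim> (\<Sum>i<d. b i * fconst (c i))"
    using span by (auto simp: spanned_def)
  have uniq: "c1 i = c2 i" if "r \<sim> (\<Sum>i<d. b i * fconst (c1 i))" "r \<sim> (\<Sum>i<d. b i * fconst (c2 i))" "i < d"
    for c1 c2 i
  proof -
    have "(\<Sum>i<d. b i * fconst (c1 i)) \<sim> (\<Sum>i<d. b i * fconst (c2 i))"
      using that(1,2) eqJ_trans eqJ_sym by blast
    then have "(\<Sum>i<d. fconst (c1 i - c2 i) * b i) \<in> J"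
      by (simp add: eqJ_def fconst_diff left_diff_distrib sum_subtractf fconst_central)
    then have "c1 i - c2 i = 0"
      using weights_independent[of "{..<d}" b \<mu> "\<lambda>i. c1 i - c2 i" i] assms that(3) by auto
    then show ?thesis by simp
  qed
  show "\<exists>!c. c \<in> {..<d} \<rightarrow>\<^sub>E UNIV \<and> r \<sim> (\<Sum>i\<in>{..<d}. b i * fconst (c i))"
  proof (rule ex1I[of _ "restrict c {..<d}"])
    show "restrict c {..<d} \<in> {..<d} \<rightarrow>\<^sub>E UNIV \<and> r \<sim> (\<Sum>i\<in>{..<d}. b i * fconst (restrict c {..<d} i))"
      using c by simp
    fix c' assume c': "c' \<in> {..<d} \<rightarrow>\<^sub>E UNIV \<and> r \<sim> (\<Sum>i\<in>{..<d}. b i * fconst (c' i))"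
    then have "c' i = c i" if "i < d" for i using uniq[OF _ c that] by blast
    then show "c' = restrict c {..<d}"
      using c' by (auto simp: fun_eq_iff PiE_def extensional_def)
  qed
qed

lemma fconst_hom: "hom_mod fconst" "central (fconst c)" "covers fconst (fconst c)"
  using central_family_fconst eqm_refl by (auto simp: central_family_def covers_def intro: exI[of _ c])

lemma spanned_fconstI:
  assumes "finite A" "k \<in> A" "z \<sim> fconst c * b k"
  shows "z \<in> spanned fconst b A"
proof -
  interpret central_hom "rea_ideal q" J fconst
    using fconst_hom by unfold_locales (auto simp: central_def)
  show ?thesis
    using spanned_cong[OF spanned_scale[OF spanned_base[OF assms(1,2)]]] assms(3)
    by (metis fconst_central)
qed

end

text \<open>Here \<open>J\<close> is the annihilator of a \<open>t\<close>-eigenvector, so the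
  generator 1 of the cyclic module is itself that eigenvector, and \<open>l2\<close> is its
  weight.\<close>

locale weight_module = simple_reflection_module q n J for q :: "'k::alg_closed_field" and n J +
  fixes l2 \<tau> \<delta> :: 'k
  assumes t_weight: "t \<sim> fconst l2" and T_scalar: "T \<sim> fconst \<tau>" and D_scalar: "D \<sim> fconst \<delta>"
begin

lemma l2_nonzero: "l2 \<noteq> 0"
proof
  assume "l2 = 0"
  then have "1 * t \<in> J" using t_weight by (simp add: eqJ_0_iff)
  then show False using torsionfree one_notin_J by blast
qed

definition quad_value :: "'k \<Rightarrow> 'k \<Rightarrow> 'k"
  where "quad_value c \<mu> = \<delta> + c * \<tau> * \<mu> - c ^ 2 * \<mu> ^ 2"

lemma weight_T: "b * T \<sim> fconst \<tau> * b" and weight_D: "b * D \<sim> fconst \<delta> * b"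
  using central_T central_D comm_sym eqJ_rmult[OF T_scalar] eqJ_rmult[OF D_scalar] eqm_eqJ_trans
  unfolding central_def comm_def by blast+

lemma weight_quad:
  assumes b: "b * t \<sim> fconst \<mu> * b"
  shows "b * quad c \<sim> fconst (quad_value c \<mu>) * b"
proof -
  have "b * (T * t) = (b * T) * t" by (simp add: mult.assoc)
  also have "\<dots> \<sim> fconst \<tau> * (b * t)" using eqJ_rmult[OF weight_T] by (simp add: mult.assoc)
  also have "\<dots> \<sim> fconst \<tau> * (fconst \<mu> * b)" by (rule eqJ_scale[OF b])
  finally have Tt: "b * (T * t) \<sim> fconst \<tau> * (fconst \<mu> * b)" .
  have "b * (t * t) = (b * t) * t" by (simp add: mult.assoc)
  also have "\<dots> \<sim> fconst \<mu> * (b * t)" using eqJ_rmult[OF b] by (simp add: mult.assoc)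
  also have "\<dots> \<sim> fconst \<mu> * (fconst \<mu> * b)" by (rule eqJ_scale[OF b])
  finally have tt: "b * (t * t) \<sim> fconst \<mu> * (fconst \<mu> * b)" .
  have "b * quad c = b * D + fconst c * (b * (T * t)) - fconst (c ^ 2) * (b * (t * t))"
    by (simp add: quad_def distrib_left right_diff_distrib fconst_left_comm[of b])
  also have "\<dots> \<sim> fconst \<delta> * b + fconst c * (fconst \<tau> * (fconst \<mu> * b))
      - fconst (c ^ 2) * (fconst \<mu> * (fconst \<mu> * b))"
    by (intro eqJ_add eqJ_diff eqJ_scale weight_D Tt tt)
  also have "\<dots> = fconst (quad_value c \<mu>) * b"
    by (simp add: quad_value_def fconst_add fconst_diff fconst_mult_left distrib_right left_diff_distrib
        power2_eq_square mult.assoc)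
  finally show ?thesis .
qed

lemma weight_u:
  assumes b: "b * t \<sim> fconst \<mu> * b"
  shows "b * u \<sim> fconst (\<tau> - ei * \<mu>) * b"
proof -
  have "b * u = b * T - fconst ei * (b * t)"
    by (simp add: u_eq right_diff_distrib fconst_left_comm)
  also have "\<dots> \<sim> fconst \<tau> * b - fconst ei * (fconst \<mu> * b)"
    by (intro eqJ_diff eqJ_scale weight_T b)
  also have "\<dots> = fconst (\<tau> - ei * \<mu>) * b"
    by (simp add: fconst_mult_left fconst_diff left_diff_distrib)
  finally show ?thesis .
qed

lemma skew_weight:
  assumes "skew b c"
  shows "b ^ r * t \<sim> fconst (c ^ r * l2) * b ^ r"
proof -
  have "b ^ r * t \<approx> fconst (c ^ r) * (t * b ^ r)"
    using skew_power[OF assms, of r] by (simp add: skew_def mult.assoc)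
  also have "\<dots> \<sim> fconst (c ^ r) * (fconst l2 * b ^ r)"
    by (intro eqJ_scale eqJ_rmult t_weight)
  finally show ?thesis by (simp add: fconst_mult_left)
qed

lemmas x_weight = skew_weight[OF skew_x] and y_weight = skew_weight[OF skew_y]

lemma x_pow_y_scalar: "x ^ Suc r * y \<sim> fconst (quad_value 1 (e ^ r * l2)) * x ^ r"
proof -
  have "x ^ Suc r * y = x ^ r * (x * y)" by (simp only: power_Suc2 mult.assoc)
  also have "\<dots> \<approx> x ^ r * quad 1" by (rule eqm_lmult[OF x_y])
  also have "\<dots> \<sim> fconst (quad_value 1 (e ^ r * l2)) * x ^ r" by (rule weight_quad[OF x_weight])
  finally show ?thesis .
qed

lemma y_pow_x_scalar: "y ^ Suc r * x \<sim> fconst (quad_value ei (ei ^ r * l2)) * y ^ r"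
proof -
  have "y ^ Suc r * x = y ^ r * quad ei" by (simp only: power_Suc2 mult.assoc flip: y_x)
  also have "\<dots> \<sim> fconst (quad_value ei (ei ^ r * l2)) * y ^ r" by (rule weight_quad[OF y_weight])
  finally show ?thesis .
qed

definition l1 :: 'k where "l1 = \<tau> - ei * l2"
definition l3 :: 'k where "l3 = quad_value ei l2"

lemma u_scalar: "u \<sim> fconst l1"
  using weight_u[of 1 l2] t_weight by (simp add: l1_def)

lemma y_x_scalar: "y * x \<sim> fconst l3"
  using y_pow_x_scalar[of 0] by (simp add: l3_def)

text \<open>Solving the definitions of \<open>l1\<close> and \<open>l3\<close> for
  \<open>\<tau>\<close> and \<open>\<delta>\<close> gives the identity. The index shifts because in
  \<open>x ^ Suc r * y\<close> the last \<open>x\<close> and the \<open>y\<close> together act on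
  the vector \<open>x ^ r\<close>.\<close>

lemma c_coeff_Suc: "quad_value 1 (e ^ r * l2) = c_coeff q l1 l2 l3 (Suc r)"
proof -
  have 2: "q ^ (2 * Suc r) = e * e ^ r" by (simp only: power_mult power_Suc)
  moreover have "q ^ (4 * s) = (q ^ (2 * s)) ^ 2" for s by (simp flip: power_mult)
  then have "q ^ (4 * Suc r) = (e * e ^ r) ^ 2" by (simp only: 2)
  moreover have "inverse (q ^ 4) = ei ^ 2" by (simp add: power_inverse flip: power_mult)
  ultimately show ?thesis
    using e0 unfolding c_coeff_def l1_def l3_def quad_value_def
    by (simp only:) (simp add: field_simps power2_eq_square)
qed

lemma x_pow_u: "x ^ r * u \<sim> x ^ r * fconst (l1 + ei * (1 - q ^ (2 * r)) * l2)"
proof -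
  have "q ^ (2 * r) = e ^ r" by (rule power_mult)
  then have "\<tau> - ei * (e ^ r * l2) = l1 + ei * (1 - q ^ (2 * r)) * l2"
    by (simp only: l1_def) (simp add: algebra_simps)
  then show ?thesis using weight_u[OF x_weight, of r] by (simp only: fconst_central)
qed

lemma x_pow_y': "1 \<le> r \<Longrightarrow> x ^ r * y \<sim> x ^ (r - 1) * fconst (c_coeff q l1 l2 l3 r)"
  using x_pow_y_scalar[of "r - 1"] by (simp only: c_coeff_Suc fconst_central) simp

lemma x_pow_t: "x ^ r * t \<sim> x ^ r * fconst (q ^ (2 * r) * l2)"
  using x_weight[of r] by (simp add: power_mult fconst_central)

lemma weights_inj:
  assumes "c = e \<or> c = ei"
  shows "inj_on (\<lambda>r. c ^ r * l2) {..<n}"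
proof -
  have *: False if "c ^ i = c ^ j" "i < j" "j < n" for i j
  proof -
    have "c \<noteq> 0" using assms e0 by auto
    then have "c ^ (j - i) = 1" using that by (simp add: power_diff)
    then have "e ^ (j - i) = 1" using assms by (auto simp: power_inverse)
    then show False using q_order[of "j - i"] that by simp
  qed
  show ?thesis
  proof (rule inj_onI)
    fix i j assume "i \<in> {..<n}" "j \<in> {..<n}" "c ^ i * l2 = c ^ j * l2"
    then show "i = j" using *[of i j] *[of j i] l2_nonzero by (cases i j rule: linorder_cases) auto
  qed
qed

lemma spanned_powers:
  assumes "0 < d"
    and "\<And>r h. r < d \<Longrightarrow> \<exists>k<d. \<exists>c. b ^ r * fvar h \<sim> fconst c * b ^ k"
  shows "spanned fconst (\<lambda>r. b ^ r) {..<d} = UNIV"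
proof (rule spanned_UNIV[OF fconst_hom])
  show "1 \<in> spanned fconst (\<lambda>r. b ^ r) {..<d}"
    using assms(1) by (intro spanned_fconstI[of _ 0 _ 1]) auto
  show "b ^ l * fvar h \<in> spanned fconst (\<lambda>r. b ^ r) {..<d}" if "l \<in> {..<d}" for l h
    using assms(2)[of l h] that by (auto intro: spanned_fconstI)
qed

text \<open>Serves two cases: the cyclic one, with \<open>d = n\<close> and \<open>c\<close>
  nonzero, and the nilpotent one, where \<open>c\<close> and \<open>c'\<close> are both 0.\<close>

lemma basis_x_powers:
  assumes d: "0 < d" "d \<le> n" and notin: "\<And>r. r < d \<Longrightarrow> x ^ r \<notin> J"
    and top: "x ^ d \<sim> fconst c" and bot: "y \<sim> fconst c' * x ^ (d - 1)"
  shows "basis d (\<lambda>r. x ^ r)"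
proof (rule basisI[OF notin x_weight])
  show "inj_on (\<lambda>r. e ^ r * l2) {..<d}"
    using weights_inj d(2) by (auto intro: inj_on_subset)
  show "spanned fconst (\<lambda>r. x ^ r) {..<d} = UNIV"
  proof (rule spanned_powers[OF d(1)])
    fix r h assume r: "r < d"
    show "\<exists>k<d. \<exists>c. x ^ r * fvar h \<sim> fconst c * x ^ k"
    proof (cases h)
      case U11
      then show ?thesis using weight_u[OF x_weight] r by blast
    next
      case U22
      then show ?thesis using x_weight r by blast
    next
      case U12
      show ?thesis
      proof (cases r)
        case 0
        then show ?thesis using U12 bot d(1) by (intro exI[of _ "d - 1"]) auto
      next
        case (Suc k)
        then show ?thesis using U12 x_pow_y_scalar[of k] r by (intro exI[of _ k]) auto
      qed
    next
      case U21
      show ?thesis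
      proof (cases "Suc r = d")
        case True
        then have "x ^ r * x \<sim> fconst c * x ^ 0" using top by (auto simp: power_commutes)
        then show ?thesis using U21 d(1) by blast
      next
        case False
        then have "x ^ r * x \<sim> fconst 1 * x ^ Suc r" by (simp add: power_commutes)
        then show ?thesis using U21 r False by (metis Suc_lessI)
      qed
    qed
  qed
qed auto

text \<open>Because \<open>x ^ n\<close> is central and acts by the invertible scalar
  \<open>\<beta>\<close>, the vector \<open>y\<close> can be recovered from
  \<open>x ^ n * y \<approx> (y * x) * x ^ (n - 1)\<close>. This is the origin of
  \<open>inverse \<beta> * l3\<close>.\<close>

lemma
  assumes "x ^ n \<sim> fconst \<beta>" "\<beta> \<noteq> 0"
  shows y_cyclic: "y \<sim> x ^ (n - 1) * fconst (inverse \<beta> * l3)"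
    and basis_cyclic: "basis n (\<lambda>r. x ^ r)"
proof -
  obtain k where k: "n = Suc k" using n0 by (cases n) auto
  have "fconst \<beta> * y \<sim> x ^ n * y" by (rule eqJ_sym[OF eqJ_rmult[OF assms(1)]])
  also have "\<dots> \<approx> (y * x) * x ^ k"
    using central_powers(1) by (simp add: central_def comm_def k mult.assoc)
  also have "\<dots> \<sim> fconst l3 * x ^ k" by (rule eqJ_rmult[OF y_x_scalar])
  finally have "fconst (inverse \<beta>) * (fconst \<beta> * y) \<sim> fconst (inverse \<beta>) * (fconst l3 * x ^ k)"
    by (rule eqJ_scale)
  then have y: "y \<sim> fconst (inverse \<beta> * l3) * x ^ k"
    using assms(2) by (simp add: fconst_mult_left)
  then show "y \<sim> x ^ (n - 1) * fconst (inverse \<beta> * l3)" by (simp add: k fconst_central)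
  show "basis n (\<lambda>r. x ^ r)"
  proof (rule basis_x_powers[OF n0 order_refl _ assms(1)])
    show "y \<sim> fconst (inverse \<beta> * l3) * x ^ (n - 1)" using y k by simp
    fix r assume "r < n"
    then have "x ^ n = x ^ r * x ^ (n - r)" by (simp flip: power_add)
    moreover have "x ^ n \<notin> J" using assms eqJ_mem fconst_mem by blast
    ultimately show "x ^ r \<notin> J" using J_rmult by metis
  qed
qed

text \<open>The mirror image of \<open>basis_cyclic\<close>: \<open>x\<close> is recovered from the
  central \<open>y ^ n\<close>, with \<open>x * y\<close> acting by \<open>quad_value 1 l2\<close>
  in place of \<open>l3\<close>.\<close>

lemma basis_cyclic':
  assumes "y ^ n \<sim> fconst \<alpha>" "\<alpha> \<noteq> 0"
  shows "basis n (\<lambda>r. y ^ r)"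
proof -
  obtain k where k: "n = Suc k" using n0 by (cases n) auto
  have "fconst \<alpha> * x \<sim> y ^ n * x" by (rule eqJ_sym[OF eqJ_rmult[OF assms(1)]])
  also have "\<dots> \<approx> (x * y) * y ^ k"
    using central_powers(2) by (simp add: central_def comm_def k mult.assoc)
  also have "\<dots> \<approx> quad 1 * y ^ k" by (rule eqm_rmult[OF x_y])
  also have "\<dots> \<sim> fconst (quad_value 1 l2) * y ^ k"
    using weight_quad[of 1 l2 1] t_weight by (intro eqJ_rmult) simp
  finally have "fconst (inverse \<alpha>) * (fconst \<alpha> * x) \<sim> fconst (inverse \<alpha>) * (fconst (quad_value 1 l2) * y ^ k)"
    by (rule eqJ_scale)
  then have x: "x \<sim> fconst (inverse \<alpha> * quad_value 1 l2) * y ^ k"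
    using assms(2) by (simp add: fconst_mult_left)
  show ?thesis
  proof (rule basisI[OF _ y_weight])
    show "inj_on (\<lambda>r. ei ^ r * l2) {..<n}" using weights_inj by blast
    fix r assume "r < n"
    then have "y ^ n = y ^ r * y ^ (n - r)" by (simp flip: power_add)
    moreover have "y ^ n \<notin> J" using assms eqJ_mem fconst_mem by blast
    ultimately show "y ^ r \<notin> J" using J_rmult by metis
  next
    show "spanned fconst (\<lambda>r. y ^ r) {..<n} = UNIV"
    proof (rule spanned_powers[OF n0])
      fix r h assume r: "r < n"
      show "\<exists>k<n. \<exists>c. y ^ r * fvar h \<sim> fconst c * y ^ k"
      proof (cases h)
        case U11
        then show ?thesis using weight_u[OF y_weight] r by blast
      next
        case U22
        then show ?thesis using y_weight r by blast
      next
        case U21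
        show ?thesis
        proof (cases r)
          case 0
          then show ?thesis using U21 x k by (intro exI[of _ k]) auto
        next
          case (Suc k)
          then show ?thesis using U21 y_pow_x_scalar[of k] r by (intro exI[of _ k]) auto
        qed
      next
        case U12
        show ?thesis
        proof (cases "Suc r = n")
          case True
          then have "y ^ r * y \<sim> fconst \<alpha> * y ^ 0" using assms(1) by (auto simp: power_commutes)
          then show ?thesis using U12 n0 by blast
        next
          case False
          then have "y ^ r * y \<sim> fconst 1 * y ^ Suc r" by (simp add: power_commutes)
          then show ?thesis using U12 r False by (metis Suc_lessI)
        qed
      qed
    qed
  qed
qed

text \<open>The factorisation shows where a chain can break: for \<open>1 \<le> r < n\<close> the
  factor \<open>e ^ r - 1\<close> is nonzero, so the coefficient vanishes exactly when
  \<open>l1 = q ^ (2 * r - 2) * l2\<close>.\<close>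

lemma c'_coeff_factor:
  assumes "1 \<le> r"
  shows "c'_coeff q l1 l2 r = ei * (e ^ r - 1) * l2 * (l1 - q ^ (2 * r - 2) * l2)"
proof -
  obtain k where k: "r = Suc k" using assms by (cases r) auto
  have 2: "q ^ (2 * r) = e * e ^ k" by (simp only: k power_mult power_Suc)
  moreover have "q ^ (4 * r) = (q ^ (2 * r)) ^ 2" by (simp flip: power_mult)
  then have "q ^ (4 * r) = (e * e ^ k) ^ 2" by (simp only: 2)
  moreover have "q ^ (2 * r - 2) = e ^ k" by (simp add: k power_mult)
  moreover have "e ^ r = e * e ^ k" by (simp add: k)
  moreover have "inverse (q ^ 4) = ei ^ 2" by (simp add: power_inverse flip: power_mult)
  ultimately show ?thesis
    using e0 unfolding c'_coeff_def
    by (simp only:) (simp add: field_simps power2_eq_square)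
qed

text \<open>The length \<open>s\<close> of the chain is pinned from two sides. Simplicity forbids a
  vanishing coefficient before \<open>s\<close>, and \<open>x ^ s * y\<close> being zero forces the
  coefficient at \<open>s\<close> to vanish; \<open>c'_coeff_factor\<close> translates both into the
  condition on \<open>l1\<close> and \<open>l2\<close>.\<close>

lemma lowest_weight:
  assumes y: "y \<in> J" and x: "x ^ n \<in> J"
  obtains s where "1 \<le> s" "s \<le> n" "x ^ s \<in> J" "\<And>r. r < s \<Longrightarrow> x ^ r \<notin> J"
    "if \<exists>r\<in>{1..<n}. l1 = q ^ (2 * r - 2) * l2
     then s \<in> {1..<n} \<and> l1 = q ^ (2 * s - 2) * l2 else s = n"
    "basis s (\<lambda>r. x ^ r)"
    "\<And>r. 1 \<le> r \<Longrightarrow> x ^ r * y \<sim> x ^ (r - 1) * fconst (c'_coeff q l1 l2 r)"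
proof -
  define s where "s = (LEAST s. x ^ s \<in> J)"
  have s: "x ^ s \<in> J" unfolding s_def using x by (rule LeastI)
  have less: "x ^ r \<notin> J" if "r < s" for r using that not_less_Least unfolding s_def by blast
  have sn: "s \<le> n" unfolding s_def using x by (rule Least_le)
  have s1: "1 \<le> s" using s one_notin_J by (cases s) auto
  \<comment> \<open>As \<open>y\<close> kills the generator, so does \<open>y * x\<close>; with
    \<open>l3 = 0\<close> the coefficients \<open>c_coeff\<close> become
    \<open>c'_coeff\<close>.\<close>
  have "fconst l3 \<in> J" using y_x_scalar eqJ_mem J_rmult[OF y, of x] by blast
  then have "l3 = 0" by (simp add: fconst_mem)
  then have act: "x ^ r * y \<sim> x ^ (r - 1) * fconst (c'_coeff q l1 l2 r)" if "1 \<le> r" for r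
    using x_pow_y'[OF that] by (simp add: c_coeff_def c'_coeff_def)
  have basis: "basis s (\<lambda>r. x ^ r)"
  proof (rule basis_x_powers[OF _ sn less])
    show "x ^ s \<sim> fconst 0" using s by (simp add: eqJ_0_iff)
    show "y \<sim> fconst 0 * x ^ (s - 1)" using y by (simp add: eqJ_0_iff)
  qed (use s1 in auto)
  \<comment> \<open>Otherwise \<open>x ^ r, \<dots>, x ^ (s - 1)\<close> would span a proper nonzero submodule.\<close>
  have nonzero: "c'_coeff q l1 l2 r \<noteq> 0" if r: "1 \<le> r" "r < s" for r
  proof
    assume c0: "c'_coeff q l1 l2 r = 0"
    let ?S = "spanned fconst (\<lambda>r. x ^ r) {r..<s}"
    have gen: "x ^ k * fvar h \<in> ?S" if k: "k \<in> {r..<s}" for k h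
    proof -
      have "\<exists>j\<in>{r..<s}. \<exists>c. x ^ k * fvar h \<sim> fconst c * x ^ j"
      proof (cases h)
        case U11
        then show ?thesis using weight_u[OF x_weight] k by blast
      next
        case U22
        then show ?thesis using x_weight k by blast
      next
        case U12
        show ?thesis
        proof (cases "k = r")
          case True
          then have "x ^ k * y \<sim> fconst 0 * x ^ r" using act[OF r(1)] c0 by simp
          then show ?thesis using U12 r atLeastLessThan_iff[of r r s] by blast
        next
          case False
          then have "x ^ k * y \<sim> fconst (c'_coeff q l1 l2 k) * x ^ (k - 1)"
            using act[of k] k r by (simp add: fconst_central)
          moreover have "k - 1 \<in> {r..<s}" using k False by auto
          ultimately show ?thesis using U12 by blast
        qed
      next
        case U21
        show ?thesis
        proof (cases "Suc k = s")
          case True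
          then have "x ^ k * x \<sim> fconst 0 * x ^ r" using s by (auto simp: power_commutes eqJ_0_iff)
          then show ?thesis using U21 r atLeastLessThan_iff[of r r s] by blast
        next
          case False
          then have "x ^ k * x \<sim> fconst 1 * x ^ Suc k" by (simp add: power_commutes)
          moreover have "Suc k \<in> {r..<s}" using k False by auto
          ultimately show ?thesis using U21 by blast
        qed
      qed
      then obtain j c where "j \<in> {r..<s}" "x ^ k * fvar h \<sim> fconst c * x ^ j" by blast
      then show ?thesis using spanned_fconstI[of "{r..<s}" j] by simp
    qed
    have base: "x ^ r \<in> ?S" using r by (intro spanned_fconstI[of _ r _ 1]) auto
    obtain z where z: "x ^ r * z \<sim> 1" using J_maximal[OF less[OF r(2)]] by blast
    have "x ^ r * z \<in> ?S" by (rule spanned_rmult[OF fconst_hom gen base])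
    then have "1 \<in> ?S" using spanned_cong eqJ_sym[OF z] by blast
    then obtain c where c: "1 \<sim> (\<Sum>k\<in>{r..<s}. x ^ k * fconst (c k))" by (auto simp: spanned_def)
    \<comment> \<open>The generator written by powers from \<open>r\<close> on is a linear relation
      with coefficient 1 at index 0, an index outside \<open>{r..<s}\<close> since \<open>r\<close>
      is positive.\<close>
    define c2 where "c2 = (\<lambda>k. if k = 0 then 1 else - c k)"
    have "(\<Sum>k\<in>insert 0 {r..<s}. fconst (c2 k) * x ^ k) = 1 + (\<Sum>k\<in>{r..<s}. fconst (c2 k) * x ^ k)"
      using r by (subst sum.insert) (auto simp: c2_def)
    also have "(\<Sum>k\<in>{r..<s}. fconst (c2 k) * x ^ k) = (\<Sum>k\<in>{r..<s}. - (x ^ k * fconst (c k)))"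
      using r by (intro sum.cong) (auto simp: c2_def fconst_uminus fconst_central)
    finally have "(\<Sum>k\<in>insert 0 {r..<s}. fconst (c2 k) * x ^ k) \<in> J"
      using c by (simp add: eqJ_def sum_negf)
    moreover have "inj_on (\<lambda>r. e ^ r * l2) (insert 0 {r..<s})"
      by (rule inj_on_subset[OF weights_inj]) (use sn n0 in auto)
    ultimately have "c2 0 = 0"
      using less r s1 x_weight
      by (intro weights_independent[of "insert 0 {r..<s}" "\<lambda>r. x ^ r" "\<lambda>r. e ^ r * l2" c2]) auto
    then show False by (simp add: c2_def)
  qed
  \<comment> \<open>For \<open>s < n\<close> the factor \<open>e ^ s - 1\<close> is nonzero, so the
    vanishing coefficient must come from the last factor.\<close>
  have zero: "l1 = q ^ (2 * s - 2) * l2" if "s < n"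
  proof -
    have "x ^ (s - 1) * fconst (c'_coeff q l1 l2 s) \<in> J"
      using act[OF s1] J_rmult[OF s, of y] eqJ_mem by blast
    then have "c'_coeff q l1 l2 s = 0" using less[of "s - 1"] s1 scale_mem by (simp add: fconst_central)
    then show ?thesis
      using c'_coeff_factor[OF s1] q_order[of s] that s1 e0 l2_nonzero by auto
  qed
  show ?thesis
  proof (rule that[OF s1 sn s less _ basis act])
    show "if \<exists>r\<in>{1..<n}. l1 = q ^ (2 * r - 2) * l2
      then s \<in> {1..<n} \<and> l1 = q ^ (2 * s - 2) * l2 else s = n"
    proof (cases "\<exists>r\<in>{1..<n}. l1 = q ^ (2 * r - 2) * l2")
      case True
      then obtain r where r: "1 \<le> r" "r < n" "l1 = q ^ (2 * r - 2) * l2" by auto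
      then have "c'_coeff q l1 l2 r = 0" using c'_coeff_factor[OF r(1)] by simp
      then have "s < n" using nonzero r by (meson not_less order_le_less_trans)
      then show ?thesis using True zero s1 by auto
    next
      case False
      then have "s = n" using zero s1 sn by fastforce
      then show ?thesis using False by auto
    qed
  qed auto
qed

end

section \<open>Modules over the reflection equation algebra\<close>

definition cls :: "'k::field \<Rightarrow> (gen, 'k) free_alg \<Rightarrow> 'k rea"
  where "cls q a = rea_ideal q +>\<^bsub>free_alg_ring\<^esub> a"

lemma cls_hom:
  "cls q (a + b) = cls q a \<oplus>\<^bsub>Aq q\<^esub> cls q b"
  "cls q (a * b) = cls q a \<otimes>\<^bsub>Aq q\<^esub> cls q b"
  "cls q 1 = \<one>\<^bsub>Aq q\<^esub>"
proof -
  have h: "cls q \<in> ring_hom free_alg_ring (Aq q)"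
    using ideal.rcos_ring_hom[OF ideal_rea_ideal] by (simp add: cls_def[abs_def] Aq_def)
  show "cls q (a + b) = cls q a \<oplus>\<^bsub>Aq q\<^esub> cls q b" "cls q (a * b) = cls q a \<otimes>\<^bsub>Aq q\<^esub> cls q b"
    "cls q 1 = \<one>\<^bsub>Aq q\<^esub>"
    using ring_hom_add[OF h, of a b] ring_hom_mult[OF h, of a b] ring_hom_one[OF h]
    by (simp_all add: free_alg_ring_def)
qed

lemma carrier_Aq: "carrier (Aq q) = range (cls q)"
  by (auto simp: cls_def Aq_def FactRing_def A_RCOSETS_def' free_alg_ring_def)

lemma cls_mem: "a \<in> rea_ideal q \<Longrightarrow> cls q a = \<zero>\<^bsub>Aq q\<^esub>"
proof -
  assume a: "a \<in> rea_ideal q"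
  interpret ideal "rea_ideal q" free_alg_ring by (rule ideal_rea_ideal)
  have "rea_ideal q +>\<^bsub>free_alg_ring\<^esub> a = rea_ideal q"
    by (rule a_rcos_const[OF a])
  then show ?thesis by (simp add: cls_def Aq_def FactRing_def)
qed

lemma gen_u_cls: "gen_u q g = cls q (fvar g)" and scal_cls: "scal q c = cls q (fconst c)"
  by (simp_all add: gen_u_def scal_def cls_def)

lemma cls_power: "cls q (a ^ k) = cls q a [^]\<^bsub>Aq q\<^esub> k"
proof -
  interpret ring "Aq q" by (rule ring_Aq)
  show ?thesis by (induction k) (simp_all add: cls_hom power_Suc2 del: power_Suc)
qed

locale rea_module = right_module "Aq q" M for q :: "'k::alg_closed_field" and M :: "('k rea, 'm) rmodule"
begin

text \<open>The action is pulled back to the free algebra, where all the preceding computations take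
  place.\<close>

definition act :: "'m \<Rightarrow> (gen, 'k) free_alg \<Rightarrow> 'm"
  where "act v a = v \<triangleleft>\<^bsub>M\<^esub> cls q a"

lemma act_closed [simp]: "v \<in> carrier M \<Longrightarrow> act v a \<in> carrier M"
  by (simp add: act_def carrier_Aq)

lemma act_add: "v \<in> carrier M \<Longrightarrow> act v (a + b) = act v a \<oplus>\<^bsub>M\<^esub> act v b"
  by (simp add: act_def cls_hom ract_add_right carrier_Aq)

lemma act_mult: "v \<in> carrier M \<Longrightarrow> act v (a * b) = act (act v a) b"
  by (simp add: act_def cls_hom ract_mult carrier_Aq)

lemma act_one: "v \<in> carrier M \<Longrightarrow> act v 1 = v"
  by (simp add: act_def cls_hom)

lemma act_0: "v \<in> carrier M \<Longrightarrow> act v 0 = \<zero>\<^bsub>M\<^esub>"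
  using act_add[of v 0 0] M.add.l_cancel_one'[of "act v 0" "act v 0"] by simp

lemma act_mem: "v \<in> carrier M \<Longrightarrow> a \<in> rea_ideal q \<Longrightarrow> act v a = \<zero>\<^bsub>M\<^esub>"
  using act_0[of v] cls_mem[of a q] cls_mem[of 0 q] ideal_cong.zero_mem[OF ideal_cong_rea_ideal[of q]]
  by (simp add: act_def)

lemma act_diff_eq_0:
  assumes "v \<in> carrier M"
  shows "act v (a - b) = \<zero>\<^bsub>M\<^esub> \<longleftrightarrow> act v a = act v b"
proof -
  have "act v a = act v (a - b) \<oplus>\<^bsub>M\<^esub> act v b"
    using act_add[OF assms, of "a - b" b] by simp
  then show ?thesis using assms M.add.r_cancel_one[of "act v b" "act v (a - b)"] by auto
qed

lemma act_sum:
  assumes "v \<in> carrier M" "finite A"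
  shows "act v (sum f A) = (\<Oplus>\<^bsub>M\<^esub>i\<in>A. act v (f i))"
  using assms(2) by (induction A rule: finite_induct) (use assms(1) in \<open>auto simp: act_0 act_add\<close>)

lemma act_zero_left: "act \<zero>\<^bsub>M\<^esub> a = \<zero>\<^bsub>M\<^esub>"
proof -
  have "act \<zero>\<^bsub>M\<^esub> a \<oplus>\<^bsub>M\<^esub> act \<zero>\<^bsub>M\<^esub> a = act \<zero>\<^bsub>M\<^esub> a"
    using ract_add_left[of "\<zero>\<^bsub>M\<^esub>" "\<zero>\<^bsub>M\<^esub>" "cls q a"] by (simp add: act_def carrier_Aq)
  then show ?thesis using M.add.l_cancel_one'[of "act \<zero>\<^bsub>M\<^esub> a" "act \<zero>\<^bsub>M\<^esub> a"] by simp
qed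

lemma act_gen: "v \<triangleleft>\<^bsub>M\<^esub> gen_u q g = act v (fvar g)" and act_scal: "v \<triangleleft>\<^bsub>M\<^esub> scal q c = act v (fconst c)"
  and act_gen_power: "v \<triangleleft>\<^bsub>M\<^esub> (gen_u q g [^]\<^bsub>Aq q\<^esub> k) = act v (fvar g ^ k)"
  and act_gen_mult: "v \<triangleleft>\<^bsub>M\<^esub> (gen_u q g \<otimes>\<^bsub>Aq q\<^esub> gen_u q h) = act v (fvar g * fvar h)"
  by (simp_all add: act_def gen_u_cls scal_cls cls_power cls_hom)

definition ann :: "'m \<Rightarrow> (gen, 'k) free_alg set"
  where "ann v = {a. act v a = \<zero>\<^bsub>M\<^esub>}"

lemma cyclic_module_ann:
  assumes "v \<in> carrier M"
  shows "cyclic_module (rea_ideal q) (ann v)"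
proof -
  interpret ideal_cong "rea_ideal q" by (rule ideal_cong_rea_ideal)
  show ?thesis
    by unfold_locales (use assms act_mem in \<open>auto simp: ann_def act_add act_mult act_zero_left\<close>)
qed

end

locale simple_torsionfree_module = reflection_algebra q n + rea_module q M
  for q :: "'k::alg_closed_field" and n and M :: "('k rea, 'm) rmodule" +
  assumes simple: "simple_right_module (Aq q) M"
    and torsionfree: "torsionfree_wrt (Aq q) M (gen_u q U22)"
begin

lemma act_surj:
  assumes v: "v \<in> carrier M" "v \<noteq> \<zero>\<^bsub>M\<^esub>" and z: "z \<in> carrier M"
  shows "\<exists>r. z = act v r"
proof -
  let ?S = "range (act v)"
  have "additive_subgroup ?S M"
  proof (unfold additive_subgroup_def, rule subgroup.intro)
    show "?S \<subseteq> carrier (add_monoid M)" using v by auto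
    show "a \<otimes>\<^bsub>add_monoid M\<^esub> b \<in> ?S" if "a \<in> ?S" "b \<in> ?S" for a b
      using that act_add[OF v(1)] by auto (metis rangeI)
    show "\<one>\<^bsub>add_monoid M\<^esub> \<in> ?S" using act_0[OF v(1)] by (metis rangeI monoid.select_convs(2))
    show "inv\<^bsub>add_monoid M\<^esub> a \<in> ?S" if "a \<in> ?S" for a
    proof -
      obtain r where r: "a = act v r" using \<open>a \<in> ?S\<close> by auto
      have "act v (- r) \<oplus>\<^bsub>M\<^esub> act v r = \<zero>\<^bsub>M\<^esub>"
        using act_add[OF v(1), of "- r" r] act_0[OF v(1)] by simp
      then have "act v (- r) = \<ominus>\<^bsub>M\<^esub> act v r"
        using v(1) M.minus_equality by simp
      then show ?thesis unfolding r by (metis a_inv_def rangeI)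
    qed
  qed
  then have "right_submodule (Aq q) M ?S"
    unfolding right_submodule_def carrier_Aq using act_mult[OF v(1)]
    by (auto simp flip: act_def) (metis rangeI)
  then have "?S = {\<zero>\<^bsub>M\<^esub>} \<or> ?S = carrier M"
    using simple unfolding simple_right_module_def by blast
  moreover have "v \<in> ?S" using act_one[OF v(1)] by (metis rangeI)
  ultimately show ?thesis using v(2) z by auto
qed

text \<open>The bridge through which every relation proved modulo a right ideal becomes an equation
  between vectors of \<open>M\<close>.\<close>

lemma eqJ_ann:
  assumes "v \<in> carrier M"
  shows "cyclic_module.eqJ (ann v) a b \<longleftrightarrow> act v a = act v b"
  unfolding cyclic_module.eqJ_def[OF cyclic_module_ann[OF assms]]
  using act_diff_eq_0[OF assms] by (simp add: ann_def)

lemma simple_ann: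
  assumes v: "v \<in> carrier M" "v \<noteq> \<zero>\<^bsub>M\<^esub>"
  shows "simple_reflection_module q n (ann v)"
proof -
  interpret cyclic_module "rea_ideal q" "ann v" by (rule cyclic_module_ann[OF v(1)])
  show ?thesis
  proof
    show "1 \<notin> ann v" using v by (simp add: ann_def act_one)
    show "\<exists>r. eqJ (a * r) 1" if a: "a \<notin> ann v" for a
    proof -
      obtain r where "v = act (act v a) r"
        using act_surj[of "act v a" v] v a by (auto simp: ann_def)
      then have "act v (a * r) = act v 1" using v by (simp add: act_mult act_one)
      then show ?thesis using eqJ_ann[OF v(1)] by auto
    qed
    show "a \<in> ann v" if "a * t \<in> ann v" for a
    proof -
      have "act v a \<triangleleft>\<^bsub>M\<^esub> (gen_u q U22 [^]\<^bsub>Aq q\<^esub> (1::nat)) = \<zero>\<^bsub>M\<^esub>"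
        unfolding act_gen_power using that v by (simp add: ann_def act_mult)
      then have "act v a = \<zero>\<^bsub>M\<^esub>"
        using torsionfree act_closed[OF v(1)] unfolding torsionfree_wrt_def by blast
      then show ?thesis by (simp add: ann_def)
    qed
  qed
qed

lemma is_K_basis_ann:
  assumes v: "v \<in> carrier M" "v \<noteq> \<zero>\<^bsub>M\<^esub>"
    and basis: "simple_reflection_module.basis (ann v) d b"
  shows "is_K_basis q M d (\<lambda>r. act v (b r))"
  unfolding is_K_basis_def
proof (intro conjI allI ballI impI)
  interpret simple_reflection_module q n "ann v" by (rule simple_ann[OF v])
  show "act v (b r) \<in> carrier M" for r using v by simp
  fix z assume "z \<in> carrier M"
  then obtain r where r: "z = act v r" using act_surj[OF v] by blast
  have sum: "(\<Oplus>\<^bsub>M\<^esub>i\<in>{..<d}. act v (b i) \<triangleleft>\<^bsub>M\<^esub> scal q (c i)) = act v (\<Sum>i\<in>{..<d}. b i * fconst (c i))" for c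
    using v by (simp add: act_sum act_scal act_mult)
  show "\<exists>!c. c \<in> {..<d} \<rightarrow>\<^sub>E UNIV \<and> z = (\<Oplus>\<^bsub>M\<^esub>i\<in>{..<d}. act v (b i) \<triangleleft>\<^bsub>M\<^esub> scal q (c i))"
    using basis unfolding basis_def r sum eqJ_ann[OF v(1)] by blast
qed

section \<open>Recognising the three types\<close>

lemma type_N1I:
  assumes v: "v \<in> carrier M" "v \<noteq> \<zero>\<^bsub>M\<^esub>" and w: "weight_module q n (ann v) l2 \<tau> \<delta>"
    and \<beta>: "act v (x ^ n) = act v (fconst \<beta>)" "\<beta> \<noteq> 0"
  shows "type_N1 q n M"
proof -
  interpret weight_module q n "ann v" l2 \<tau> \<delta> by (rule w)
  note eq = eqJ_ann[OF v(1)]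
  obtain \<alpha> where \<alpha>: "eqJ (y ^ n) (fconst \<alpha>)" using central_scalars(4) by blast
  have \<beta>': "eqJ (x ^ n) (fconst \<beta>)" using \<beta> eq by simp
  have fold: "act (act v a) b = act v (a * b)" for a b using v by (simp add: act_mult)
  show ?thesis
    unfolding type_N1_def Let_def act_gen_power act_gen act_scal act_gen_mult
  proof (rule conjI[OF simple], rule exI[of _ \<alpha>], rule exI[of _ \<beta>], rule exI[of _ l1],
      rule exI[of _ l2], rule exI[of _ l3], rule conjI[OF \<beta>(2)], rule conjI[OF l2_nonzero],
      rule bexI[OF _ v(1)], rule conjI[OF v(2)], unfold fold, intro conjI allI impI)
    show "act v (y ^ n) = act v (fconst \<alpha>)" using \<alpha> eq by simp
    show "act v (x ^ n) = act v (fconst \<beta>)" by (rule \<beta>)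
    show "act v u = act v (fconst l1)" using u_scalar eq by simp
    show "act v t = act v (fconst l2)" using t_weight eq by simp
    show "act v (y * x) = act v (fconst l3)" using y_x_scalar eq by simp
    show "is_K_basis q M n (\<lambda>r. act v (x ^ r))"
      by (rule is_K_basis_ann[OF v basis_cyclic[OF \<beta>' \<beta>(2)]])
    show "act v (x ^ r * u) = act v (x ^ r * fconst (l1 + ei * (1 - q ^ (2 * r)) * l2))" for r
      using x_pow_u eq by simp
    show "act v (x ^ r * y) = act v (x ^ (r - 1) * fconst (c_coeff q l1 l2 l3 r))" if "1 \<le> r \<and> r < n" for r
      using x_pow_y'[of r] that eq by simp
    show "act v y = act v (x ^ (n - 1) * fconst (inverse \<beta> * l3))"
      using y_cyclic[OF \<beta>' \<beta>(2)] eq by simp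
    show "act v (x ^ r * x) = act v (x ^ (r + 1))" for r by (simp add: power_commutes)
    have "x ^ (n - 1) * x = x ^ n" using n0 by (metis power_minus_mult)
    then show "act v (x ^ (n - 1) * x) = act v (fconst \<beta>)" using \<beta> by simp
    show "act v (x ^ r * t) = act v (x ^ r * fconst (q ^ (2 * r) * l2))" for r
      using x_pow_t eq by simp
  qed
qed

lemma type_N2I:
  assumes v: "v \<in> carrier M" "v \<noteq> \<zero>\<^bsub>M\<^esub>" and w: "weight_module q n (ann v) l2 \<tau> \<delta>"
    and \<alpha>: "act v (y ^ n) = act v (fconst \<alpha>)" "\<alpha> \<noteq> 0" and x: "act v (x ^ n) = \<zero>\<^bsub>M\<^esub>"
  shows "type_N2 q n M"
proof -
  interpret weight_module q n "ann v" l2 \<tau> \<delta> by (rule w)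
  note eq = eqJ_ann[OF v(1)]
  have \<alpha>': "eqJ (y ^ n) (fconst \<alpha>)" using \<alpha> eq by simp
  show ?thesis
    unfolding type_N2_def Let_def act_gen_power act_gen act_scal act_gen_mult
  proof (rule conjI[OF simple], rule exI[of _ \<alpha>], rule exI[of _ l1], rule exI[of _ l2],
      rule exI[of _ l3], rule conjI[OF \<alpha>(2)], rule conjI[OF l2_nonzero],
      rule bexI[OF _ v(1)], rule conjI[OF v(2)], intro conjI \<alpha>(1) x)
    show "act v u = act v (fconst l1)" using u_scalar eq by simp
    show "act v t = act v (fconst l2)" using t_weight eq by simp
    show "act v (y * x) = act v (fconst l3)" using y_x_scalar eq by simp
    show "is_K_basis q M n (\<lambda>r. act v (y ^ r))"
      by (rule is_K_basis_ann[OF v basis_cyclic'[OF \<alpha>' \<alpha>(2)]])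
  qed
qed

text \<open>Every vector is \<open>act v r\<close>, and \<open>c\<close> can be moved in front of
  \<open>r\<close>, where it meets \<open>v\<close>. Type \<open>N3\<close> requires such vanishing
  on the whole module.\<close>

lemma central_annihilates:
  assumes v: "v \<in> carrier M" "v \<noteq> \<zero>\<^bsub>M\<^esub>" and c: "central c" and 0: "act v c = \<zero>\<^bsub>M\<^esub>"
    and z: "z \<in> carrier M"
  shows "act z c = \<zero>\<^bsub>M\<^esub>"
proof -
  obtain r where r: "z = act v r" using act_surj[OF v z] by blast
  have "c * r - r * c \<in> rea_ideal q" using c by (simp add: central_def comm_def eqm_def)
  then have "act v (c * r) = act v (r * c)" using act_mem[OF v(1)] act_diff_eq_0[OF v(1)] by blast
  then show ?thesis using v(1) by (simp add: r act_mult 0 act_zero_left)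
qed

lemma type_N3I:
  assumes v: "v \<in> carrier M" "v \<noteq> \<zero>\<^bsub>M\<^esub>" and w: "weight_module q n (ann v) l2 \<tau> \<delta>"
    and y0: "act v y = \<zero>\<^bsub>M\<^esub>"
    and yn: "act v (y ^ n) = \<zero>\<^bsub>M\<^esub>" and xn: "act v (x ^ n) = \<zero>\<^bsub>M\<^esub>"
  shows "type_N3 q n M"
proof -
  interpret weight_module q n "ann v" l2 \<tau> \<delta> by (rule w)
  note eq = eqJ_ann[OF v(1)]
  have "y \<in> ann v" "x ^ n \<in> ann v" using y0 xn by (auto simp: ann_def)
  then obtain s where s: "1 \<le> s" "s \<le> n" "x ^ s \<in> ann v" "\<And>r. r < s \<Longrightarrow> x ^ r \<notin> ann v"
    "if \<exists>r\<in>{1..<n}. l1 = q ^ (2 * r - 2) * l2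
     then s \<in> {1..<n} \<and> l1 = q ^ (2 * s - 2) * l2 else s = n"
    "basis s (\<lambda>r. x ^ r)"
    "\<And>r. 1 \<le> r \<Longrightarrow> eqJ (x ^ r * y) (x ^ (r - 1) * fconst (c'_coeff q l1 l2 r))"
    by (rule lowest_weight) (rule that; blast)
  have fold: "act (act v a) b = act v (a * b)" for a b using v by (simp add: act_mult)
  show ?thesis
    unfolding type_N3_def Let_def act_gen_power act_gen act_scal act_gen_mult
  proof (rule conjI[OF simple], rule conjI[rotated], rule conjI[rotated], rule exI[of _ l1],
      rule exI[of _ l2], rule exI[of _ s], rule conjI[OF l2_nonzero], rule bexI[OF _ v(1)],
      rule conjI[OF v(2)], unfold fold, intro conjI allI impI y0 s(1,2,5))
    show "\<forall>z\<in>carrier M. act z (y ^ n) = \<zero>\<^bsub>M\<^esub>" "\<forall>z\<in>carrier M. act z (x ^ n) = \<zero>\<^bsub>M\<^esub>"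
      using central_annihilates[OF v] central_powers yn xn by auto
    show "act v u = act v (fconst l1)" using u_scalar eq by simp
    show "act v t = act v (fconst l2)" using t_weight eq by simp
    show xs: "act v (x ^ s) = \<zero>\<^bsub>M\<^esub>" using s(3) by (simp add: ann_def)
    show "act v (x ^ r) \<noteq> \<zero>\<^bsub>M\<^esub>" if "1 \<le> r \<and> r < s" for r using s(4) that by (simp add: ann_def)
    show "is_K_basis q M s (\<lambda>r. act v (x ^ r))" by (rule is_K_basis_ann[OF v s(6)])
    show "act v (x ^ r * u) = act v (x ^ r * fconst (l1 + ei * (1 - q ^ (2 * r)) * l2))" for r
      using x_pow_u eq by simp
    show "act v (x ^ r * y) = act v (x ^ (r - 1) * fconst (c'_coeff q l1 l2 r))" if "1 \<le> r \<and> r < s" for r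
      using s(7)[of r] that eq by simp
    show "act v (x ^ r * x) = act v (x ^ (r + 1))" for r by (simp add: power_commutes)
    have "x ^ (s - 1) * x = x ^ s" using s(1) by (metis power_minus_mult less_eq_Suc_le One_nat_def)
    then show "act v (x ^ (s - 1) * x) = \<zero>\<^bsub>M\<^esub>" using xs by simp
    show "act v (x ^ r * t) = act v (x ^ r * fconst (q ^ (2 * r) * l2))" for r
      using x_pow_t eq by simp
  qed
qed

lemma weight_module_ann:
  assumes v: "v \<in> carrier M" "v \<noteq> \<zero>\<^bsub>M\<^esub>" and t: "act v t = act v (fconst l)"
  obtains \<tau> \<delta> where "weight_module q n (ann v) l \<tau> \<delta>"
proof -
  interpret simple_reflection_module q n "ann v" by (rule simple_ann[OF v])
  obtain \<tau> \<delta> where "eqJ T (fconst \<tau>)" "eqJ D (fconst \<delta>)" using central_scalars(1,2) by blast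
  then have "weight_module q n (ann v) l \<tau> \<delta>"
    using t eqJ_ann[OF v(1)] by unfold_locales auto
  then show ?thesis by (rule that)
qed

lemma act_weight:
  assumes v: "v \<in> carrier M" and a: "act v (a * t) = act v (fconst l * a)"
  shows "act (act v a) t = act (act v a) (fconst l)"
  using a v by (simp add: act_mult[symmetric] fconst_central)

lemma classification: "type_N1 q n M \<or> type_N2 q n M \<or> type_N3 q n M"
proof -
  have "carrier M \<noteq> {\<zero>\<^bsub>M\<^esub>}" using simple by (simp add: simple_right_module_def)
  then obtain v0 where v0: "v0 \<in> carrier M" "v0 \<noteq> \<zero>\<^bsub>M\<^esub>" using M.zero_closed by blast
  interpret J0: simple_reflection_module q n "ann v0" by (rule simple_ann[OF v0])
  obtain a l where a: "a \<notin> ann v0" "J0.eqJ (a * t) (fconst l * a)" using J0.t_eigenvector by blast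
  define v where "v = act v0 a"
  have v: "v \<in> carrier M" "v \<noteq> \<zero>\<^bsub>M\<^esub>" using a(1) v0 by (auto simp: v_def ann_def)
  have vt: "act v t = act v (fconst l)"
    unfolding v_def using a(2) by (intro act_weight v0) (simp add: eqJ_ann[OF v0(1)])
  obtain \<tau> \<delta> where w: "weight_module q n (ann v) l \<tau> \<delta>" by (rule weight_module_ann[OF v vt])
  interpret weight_module q n "ann v" l \<tau> \<delta> by (rule w)
  note eq = eqJ_ann[OF v(1)]
  obtain \<alpha> \<beta> where \<beta>: "act v (x ^ n) = act v (fconst \<beta>)" and \<alpha>: "act v (y ^ n) = act v (fconst \<alpha>)"
    using central_scalars(3,4) eq by blast
  show ?thesis
  proof (cases "\<beta> = 0 \<and> \<alpha> = 0")
    case False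
    show ?thesis
    proof (cases "\<beta> = 0")
      case True
      then show ?thesis using False \<beta> type_N2I[OF v w \<alpha>] act_0[OF v(1)] by simp
    qed (use type_N1I[OF v w \<beta>] in simp)
  next
    case True
    have 0: "act v (x ^ n) = \<zero>\<^bsub>M\<^esub>" "act v (y ^ n) = \<zero>\<^bsub>M\<^esub>"
      using True \<alpha> \<beta> act_0[OF v(1)] by auto
    \<comment> \<open>Some power of \<open>y\<close> kills \<open>v\<close>, so the last nonzero
      vector \<open>act v (y ^ j)\<close> is killed by \<open>y\<close>. It is still a
      \<open>t\<close>-eigenvector, of weight \<open>ei ^ j * l\<close>, and replaces
      \<open>v\<close> as generator.\<close>
    define k where "k = (LEAST k. act v (y ^ k) = \<zero>\<^bsub>M\<^esub>)"
    have k: "act v (y ^ k) = \<zero>\<^bsub>M\<^esub>" unfolding k_def using 0(2) by (rule LeastI)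
    then obtain j where j: "k = Suc j" using v act_one by (cases k) auto
    have nz: "act v (y ^ j) \<noteq> \<zero>\<^bsub>M\<^esub>"
      using not_less_Least[of j "\<lambda>k. act v (y ^ k) = \<zero>\<^bsub>M\<^esub>"] j k_def by simp
    define w where "w = act v (y ^ j)"
    have w: "w \<in> carrier M" "w \<noteq> \<zero>\<^bsub>M\<^esub>" using v nz by (auto simp: w_def)
    have "act w t = act w (fconst (ei ^ j * l))"
      unfolding w_def using y_weight[of j] eq by (intro act_weight v) simp
    then obtain \<tau>' \<delta>' where wm: "weight_module q n (ann w) (ei ^ j * l) \<tau>' \<delta>'"
      by (rule weight_module_ann[OF w])
    have "act w y = act v (y ^ k)" using v by (simp add: w_def j power_Suc2 act_mult del: power_Suc)
    then have "type_N3 q n M"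
      using type_N3I[OF w wm] k 0 central_annihilates[OF v _ _ w(1)] central_powers by auto
    then show ?thesis by blast
  qed
qed

end

text \<open>The order of \<open>q ^ 2\<close> is \<open>m\<close> divided by the greatest common
  divisor of \<open>m\<close> and 2, and this is \<open>n_of m\<close>.\<close>

lemma reflection_algebra_primitive_root:
  fixes q :: "'k::alg_closed_field"
  assumes "q \<noteq> 0" and m: "primitive_root_of_unity m q"
  shows "reflection_algebra q (n_of m)"
proof
  have m0: "m > 0" and qm: "q ^ m = 1" and prim: "\<And>k. 0 < k \<Longrightarrow> k < m \<Longrightarrow> q ^ k \<noteq> 1"
    using m by (auto simp: primitive_root_of_unity_def)
  show "q \<noteq> 0" by fact
  show "n_of m > 0" using m0 by (auto simp: n_of_def elim: evenE)
  show "(q ^ 2) ^ n_of m = 1"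
  proof (cases "odd m")
    case True
    have "(q ^ 2) ^ m = (q ^ m) ^ 2" by (simp add: mult.commute flip: power_mult)
    then show ?thesis using qm True by (simp add: n_of_def)
  next
    case False
    then have "2 * (m div 2) = m" by simp
    then show ?thesis using qm False by (simp add: n_of_def flip: power_mult)
  qed
  fix j assume j: "0 < j" "j < n_of m"
  show "(q ^ 2) ^ j \<noteq> 1"
  proof
    assume "(q ^ 2) ^ j = 1"
    then have one: "q ^ (2 * j) = 1" by (simp add: power_mult)
    show False
    proof (cases "2 * j < m")
      case True
      then show False using prim[of "2 * j"] j one by simp
    next
      \<comment> \<open>Below \<open>n_of m\<close> this happens only for odd \<open>m\<close>. Then
        \<open>2 * j\<close> differs from \<open>m\<close>, and \<open>2 * j - m\<close> is a
        positive exponent below \<open>m\<close> at which the power of \<open>q\<close> would be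
        1.\<close>
      case False
      then have odd: "odd m" using j by (auto simp: n_of_def split: if_splits)
      then have gt: "m < 2 * j" and lt: "2 * j - m < m"
        using False j by (auto simp: n_of_def) (metis dvd_triv_left le_neq_implies_less not_less)
      have "q ^ (2 * j) = q ^ (2 * j - m) * q ^ m" using gt by (simp flip: power_add)
      then show False using prim[of "2 * j - m"] gt lt one qm by simp
    qed
  qed
qed

theorem theorem6p2p1:
  fixes q :: "'k::alg_closed_field" and m :: nat
    and M :: "('k rea, 'm) rmodule"
  assumes "q \<noteq> 0"
    and "primitive_root_of_unity m q"
    and "simple_right_module (Aq q) M"
    and "torsionfree_wrt (Aq q) M (gen_u q U22)"
  shows "\<exists>N :: ('k rea, 'm) rmodule.
           (type_N1 q (n_of m) N \<or> type_N2 q (n_of m) N \<or> type_N3 q (n_of m) N) \<and>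
           right_module_iso (Aq q) M N"
proof -
  interpret right_module "Aq q" M using assms(3) by (simp add: simple_right_module_def)
  interpret reflection_algebra q "n_of m"
    by (rule reflection_algebra_primitive_root[OF assms(1,2)])
  interpret simple_torsionfree_module q "n_of m" M
    by unfold_locales (use assms in auto)
  \<comment> \<open>The types are properties of a module, so \<open>M\<close> itself serves as
    \<open>N\<close>, with the identity as isomorphism.\<close>
  have "right_module_iso (Aq q) M M"
    unfolding right_module_iso_def by (rule exI[of _ id]) auto
  then show ?thesis using classification by blast
qed

end
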